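(* The partition $\{C_i^{-},C_i^{+}:0\le i\le d-1\}$ of $X$ (into nonempty cells $C_i^-=C_i\cap\Gamma_i(x)$ and $C_i^+=C_i\cap\Gamma_{i+1}(x)$) is equitable; that is, for any two cells $P,Q$ of the partition, the number $|\Gamma(z)\cap Q|$ is the same for all $z\in P$.
   Context: **Graph.** $\Gamma$ is a finite undirected connected graph without loops or multiple edges, with vertex set $X$, path-length distance $\partial$ and diameter $d\ge 3$; $\Gamma_i(y)=\{z\in X:\partial(y,z)=i\}$, $\Gamma(y)=\Gamma_1(y)$. $\Gamma$ is distance-regular: $p^h_{ij}=|\Gamma_i(y)\cap\Gamma_j(z)|$ depends only on $i,j$ and $h=\partial(y,z)$. Put $a_i=p^i_{1,i}$, $b_i=p^i_{1,i+1}$, $c_i=p^i_{1,i-1}$ ($b_d=c_0=0$), $k=b_0$. Complex matrices indexed by $X$ act on $\mathbf V=\mathbb C^X$; $\hat y$ is the standard basis vector at $y$. $A_i$ is the $i$-th distance matrix, $A=A_1$, $\mathcal M$ is the algebra generated by $A$ (Bose–Mesner algebra), with primitive idempotents $E_0=|X|^{-1}J,E_1,\dots,E_d$ ($J$ all-ones) and $A=\sum_i\theta_iE_i$. $\Gamma$ is $Q$-polynomial with respect to $E_0,\dots,E_d$: writing $E_i\circ E_j=|X|^{-1}\sum_h q^h_{ij}E_h$ (entrywise product), $q^h_{ij}=0$ (resp. $\ne0$) if one of $h,i,j$ is greater than (resp. equal to) the sum of the other two. It is assumed that $\theta_0>\theta_1>\dots>\theta_d$. **Clique.** $C\subseteq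 X$ is a Delsarte clique: a nonempty set of mutually adjacent vertices with $|C|=1-k/\theta_d$. Fix $x\in C$. $A^*=A^*(x)$ is the diagonal matrix with $(z,z)$-entry $|X|(E_1)_{xz}$; $E^*_i$ ($0\le i\le d$) is the diagonal projection onto $\mathrm{Span}\{\hat z:\partial(x,z)=i\}$, and $A^*=\sum_i\theta^*_iE^*_i$. For $0\le i\le d-1$, $C_i=\{y\in X:\partial(y,C)=i\}$, where $\partial(y,C)=\min_{z\in C}\partial(y,z)$; the sets $C_0,\dots,C_{d-1}$ partition $X$. **Leonard systems.** On a complex vector space $V$ of dimension $n+1$, a Leonard system of diameter $n$ is a sequence $(B;B^*;\{F_i\}_{i=0}^n;\{F^*_i\}_{i=0}^n)$ where $B,B^*\in\mathrm{End}(V)$ each have $n+1$ distinct eigenvalues, $\{F_i\}$ (resp. $\{F_i^*\}$) is an ordering of the primitive idempotents (spectral projections) of $B$ (resp. $B^*$), and $F_iB^*F_j$, $F^*_iBF^*_j$ are $0$ if $|i-j|>1$ and nonzero if $|i-j|=1$. Eigenvalues $\vartheta_i$, dual eigenvalues $\vartheta^*_i$ are defined by $BF_i=\vartheta_iF_i$, $B^*F_i^*=\vartheta_i^*F_i^*$. The first split sequence is the sequence of nonzero scalars $\varphi_1,\dots,\varphi_n$ such that in some basis $B$ is lower bidiagonal with diagonal $\vartheta_0,\dots,\vartheta_n$ and subdiagonal entries $1$, and $B^*$ is upper bidiagonal with diagonal $\vartheta^*_0,\dots,\vartheta_n^*$ and superdiagonal $\varphi_1,\dots,\varphi_n$. The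 second split sequence $\{\phi_i\}$ is the first split sequence of $(B;B^*;\{F_{n-i}\};\{F^*_i\})$. The parameter array is $(\{\vartheta_i\},\{\vartheta_i^*\},\{\varphi_i\},\{\phi_i\})$. **$q$-Racah assumption.** $q\in\mathbb C$ is nonzero, $q^2\neq1$. $(A;A^*;\{E_i\}_{i=0}^d;\{E_i^*\}_{i=0}^d)$ acts on $\mathcal M\hat x$ (of dimension $d+1$) as a Leonard system $\Phi$ with parameter array $(\{\theta_i\},\{\theta^*_i\},\{\varphi_i\},\{\phi_i\})$. $\Gamma$ is assumed to have $q$-Racah type: there are nonzero $h,h^*,s,s^*,r_1,r_2\in\mathbb C$ (fixed) with $r_1r_2=ss^*q^{d+1}$, none of $q^i,r_1q^i,r_2q^i,s^*q^i/r_1,s^*q^i/r_2$ equal to $1$ for $1\le i\le d$, neither of $sq^i,s^*q^i$ equal to $1$ for $2\le i\le 2d$, and $\theta_i=\theta_0+h(1-q^i)(1-sq^{i+1})q^{-i}$, $\theta^*_i=\theta^*_0+h^*(1-q^i)(1-s^*q^{i+1})q^{-i}$ ($0\le i\le d$), $\varphi_i=hh^*q^{1-2i}(1-q^i)(1-q^{i-d-1})(1-r_1q^i)(1-r_2q^i)$, $\phi_i=hh^*q^{1-2i}(1-q^i)(1-q^{i-d-1})(r_1-s^*q^i)(r_2-s^*q^i)/s^*$ ($1\le i\le d$). *)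

theory Defs
  imports "HOL-Analysis.Analysis" "HOL-Library.Disjoint_Sets"
begin

text \<open>
  A graph is an adjacency relation on a finite type; the vertex set \<open>X\<close> is the whole type.
  Complex matrices indexed by \<open>X\<close> act on \<open>complex ^ 'v\<close> by \<open>*v\<close>. Families indexed by
  \<open>0, \<dots>, d\<close> are functions on \<open>nat\<close> of which only the values at indices \<open>\<le> d\<close> matter.
\<close>

section \<open>Distance-regular graphs\<close>

definition simple_graph :: "('v \<Rightarrow> 'v \<Rightarrow> bool) \<Rightarrow> bool" where
  "simple_graph adj \<longleftrightarrow> (\<forall>y z. adj y z \<longrightarrow> adj z y) \<and> (\<forall>y. \<not> adj y y)"

definition connected_graph :: "('v \<Rightarrow> 'v \<Rightarrow> bool) \<Rightarrow> bool" where
  "connected_graph adj \<longleftrightarrow> (\<forall>y z. adj\<^sup>*\<^sup>* y z)"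

text \<open>\<open>(adj ^^ n) y z\<close> says that there is a walk of length \<open>n\<close> from \<open>y\<close> to \<open>z\<close>.\<close>

definition gdist :: "('v \<Rightarrow> 'v \<Rightarrow> bool) \<Rightarrow> 'v \<Rightarrow> 'v \<Rightarrow> nat" where
  "gdist adj y z = (LEAST n. (adj ^^ n) y z)"

definition graph_diameter :: "('v::finite \<Rightarrow> 'v \<Rightarrow> bool) \<Rightarrow> nat" where
  "graph_diameter adj = Max {gdist adj y z | y z. True}"

definition gsphere :: "('v \<Rightarrow> 'v \<Rightarrow> bool) \<Rightarrow> nat \<Rightarrow> 'v \<Rightarrow> 'v set" where
  "gsphere adj i y = {z. gdist adj y z = i}"

definition distance_regular :: "('v::finite \<Rightarrow> 'v \<Rightarrow> bool) \<Rightarrow> bool" where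
  "distance_regular adj \<longleftrightarrow>
     (\<forall>h i j. \<exists>n. \<forall>y z. gdist adj y z = h \<longrightarrow> card (gsphere adj i y \<inter> gsphere adj j z) = n)"

text \<open>\<open>intersection_number adj h i j\<close> is \<open>p\<^sup>h\<^sub>i\<^sub>j\<close>; it is meaningful for \<open>h\<close> up to the diameter of a
  distance-regular graph.\<close>

definition intersection_number :: "('v::finite \<Rightarrow> 'v \<Rightarrow> bool) \<Rightarrow> nat \<Rightarrow> nat \<Rightarrow> nat \<Rightarrow> nat" where
  "intersection_number adj h i j =
     (THE n. \<forall>y z. gdist adj y z = h \<longrightarrow> card (gsphere adj i y \<inter> gsphere adj j z) = n)"

definition b_number :: "('v::finite \<Rightarrow> 'v \<Rightarrow> bool) \<Rightarrow> nat \<Rightarrow> nat" where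
  "b_number adj i = intersection_number adj i 1 (i + 1)"

definition valency :: "('v::finite \<Rightarrow> 'v \<Rightarrow> bool) \<Rightarrow> nat" where
  "valency adj = b_number adj 0"


section \<open>The Bose-Mesner algebra and the Q-polynomial property\<close>

definition mat_scale :: "complex \<Rightarrow> complex ^ 'n ^ 'm \<Rightarrow> complex ^ 'n ^ 'm"  (infixl "*k" 70) where
  "c *k M = (\<chi> i j. c * M $ i $ j)"

definition adjacency_matrix :: "('v::finite \<Rightarrow> 'v \<Rightarrow> bool) \<Rightarrow> complex ^ 'v ^ 'v" where
  "adjacency_matrix adj = (\<chi> y z. if gdist adj y z = 1 then 1 else 0)"

inductive_set generated_algebra :: "complex ^ 'v ^ 'v \<Rightarrow> (complex ^ 'v ^ 'v) set"
  for M :: "complex ^ 'v ^ 'v" where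
  one: "mat 1 \<in> generated_algebra M"
| gen: "M \<in> generated_algebra M"
| add: "P \<in> generated_algebra M \<Longrightarrow> Q \<in> generated_algebra M \<Longrightarrow> P + Q \<in> generated_algebra M"
| scale: "P \<in> generated_algebra M \<Longrightarrow> c *k P \<in> generated_algebra M"
| mult: "P \<in> generated_algebra M \<Longrightarrow> Q \<in> generated_algebra M \<Longrightarrow> P ** Q \<in> generated_algebra M"

definition bose_mesner :: "('v::finite \<Rightarrow> 'v \<Rightarrow> bool) \<Rightarrow> (complex ^ 'v ^ 'v) set" where
  "bose_mesner adj = generated_algebra (adjacency_matrix adj)"

definition primitive_idempotents :: "(complex ^ 'v ^ 'v) set \<Rightarrow> (complex ^ 'v ^ 'v) set" where
  "primitive_idempotents R =
     {e \<in> R. e \<noteq> 0 \<and> e ** e = e \<and>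
        (\<forall>f\<in>R. \<forall>g\<in>R. f ** f = f \<and> g ** g = g \<and> f ** g = 0 \<and> g ** f = 0 \<and> e = f + g
           \<longrightarrow> f = 0 \<or> g = 0)}"

definition hadamard :: "complex ^ 'v ^ 'v \<Rightarrow> complex ^ 'v ^ 'v \<Rightarrow> complex ^ 'v ^ 'v" where
  "hadamard P Q = (\<chi> y z. P $ y $ z * Q $ y $ z)"

text \<open>\<open>\<kappa> h i j\<close> is the Krein parameter \<open>q\<^sup>h\<^sub>i\<^sub>j\<close>.\<close>

definition q_polynomial :: "nat \<Rightarrow> (nat \<Rightarrow> complex ^ 'v ^ 'v::finite) \<Rightarrow> bool" where
  "q_polynomial d E \<longleftrightarrow>
     (\<exists>\<kappa> :: nat \<Rightarrow> nat \<Rightarrow> nat \<Rightarrow> complex.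
        (\<forall>i\<le>d. \<forall>j\<le>d.
           hadamard (E i) (E j) = (1 / of_nat CARD('v)) *k (\<Sum>h\<le>d. \<kappa> h i j *k E h)) \<and>
        (\<forall>h\<le>d. \<forall>i\<le>d. \<forall>j\<le>d.
           (h > i + j \<or> i > h + j \<or> j > h + i \<longrightarrow> \<kappa> h i j = 0) \<and>
           (h = i + j \<or> i = h + j \<or> j = h + i \<longrightarrow> \<kappa> h i j \<noteq> 0)))"

definition dual_adjacency_matrix ::
    "(nat \<Rightarrow> complex ^ 'v ^ 'v::finite) \<Rightarrow> 'v \<Rightarrow> complex ^ 'v ^ 'v" where
  "dual_adjacency_matrix E x =
     (\<chi> y z. if y = z then of_nat CARD('v) * E 1 $ x $ z else 0)"

definition dual_idempotent ::
    "('v::finite \<Rightarrow> 'v \<Rightarrow> bool) \<Rightarrow> 'v \<Rightarrow> nat \<Rightarrow> complex ^ 'v ^ 'v" where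
  "dual_idempotent adj x i = (\<chi> y z. if y = z \<and> gdist adj x z = i then 1 else 0)"

text \<open>The space \<open>\<M> x\<close>, where \<open>x\<close> stands for its standard basis vector.\<close>

definition primary_module :: "('v::finite \<Rightarrow> 'v \<Rightarrow> bool) \<Rightarrow> 'v \<Rightarrow> (complex ^ 'v) set" where
  "primary_module adj x = {P *v axis x 1 | P. P \<in> bose_mesner adj}"


section \<open>Leonard systems\<close>

text \<open>
  The underlying space is a subspace \<open>V\<close> of \<open>complex ^ 'v\<close>. An endomorphism of \<open>V\<close> is given by a
  matrix that leaves \<open>V\<close> invariant, and only its restriction to \<open>V\<close> matters: every condition
  below is relative to vectors of \<open>V\<close>.
\<close>

definition invariant_on :: "(complex ^ 'v) set \<Rightarrow> complex ^ 'v ^ 'v::finite \<Rightarrow> bool" where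
  "invariant_on V B \<longleftrightarrow> (\<forall>v\<in>V. B *v v \<in> V)"

definition zero_on :: "(complex ^ 'v) set \<Rightarrow> complex ^ 'v ^ 'v::finite \<Rightarrow> bool" where
  "zero_on V B \<longleftrightarrow> (\<forall>v\<in>V. B *v v = 0)"

definition eigenspace_on ::
    "(complex ^ 'v) set \<Rightarrow> complex ^ 'v ^ 'v::finite \<Rightarrow> complex \<Rightarrow> (complex ^ 'v) set" where
  "eigenspace_on V B t = {v \<in> V. B *v v = t *s v}"

text \<open>For \<open>B\<close> diagonalizable on \<open>V\<close>: \<open>P\<close> acts on \<open>V\<close> as the projection onto the \<open>t\<close>-eigenspace
  along the other eigenspaces.\<close>

definition spectral_projection_on ::
    "(complex ^ 'v) set \<Rightarrow> complex ^ 'v ^ 'v::finite \<Rightarrow> complex \<Rightarrow> complex ^ 'v ^ 'v \<Rightarrow> bool" where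
  "spectral_projection_on V B t P \<longleftrightarrow>
     (\<forall>v\<in>V. P *v v \<in> eigenspace_on V B t) \<and>
     (\<forall>v\<in>eigenspace_on V B t. P *v v = v) \<and>
     (\<forall>t'. t' \<noteq> t \<longrightarrow> (\<forall>v\<in>eigenspace_on V B t'. P *v v = 0))"

text \<open>For \<open>dim V = n + 1\<close>: \<open>B\<close> has \<open>n + 1\<close> distinct eigenvalues on \<open>V\<close>, and \<open>F 0, \<dots>, F n\<close> is an
  ordering of its primitive idempotents.\<close>

definition idempotent_ordering ::
    "(complex ^ 'v) set \<Rightarrow> nat \<Rightarrow> complex ^ 'v ^ 'v::finite \<Rightarrow> (nat \<Rightarrow> complex ^ 'v ^ 'v) \<Rightarrow> bool" where
  "idempotent_ordering V n B F \<longleftrightarrow>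
     (\<exists>\<theta>. inj_on \<theta> {..n} \<and>
        (\<forall>i\<le>n. eigenspace_on V B (\<theta> i) \<noteq> {0} \<and> spectral_projection_on V B (\<theta> i) (F i)))"

definition leonard_system ::
    "(complex ^ 'v) set \<Rightarrow> nat \<Rightarrow> complex ^ 'v ^ 'v::finite \<Rightarrow> complex ^ 'v ^ 'v \<Rightarrow>
     (nat \<Rightarrow> complex ^ 'v ^ 'v) \<Rightarrow> (nat \<Rightarrow> complex ^ 'v ^ 'v) \<Rightarrow> bool" where
  "leonard_system V n B Bs F Fs \<longleftrightarrow>
     vec.subspace V \<and> vec.dim V = n + 1 \<and>
     invariant_on V B \<and> invariant_on V Bs \<and>
     idempotent_ordering V n B F \<and> idempotent_ordering V n Bs Fs \<and>
     (\<forall>i\<le>n. \<forall>j\<le>n.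
        (\<bar>int i - int j\<bar> > 1 \<longrightarrow> zero_on V (F i ** Bs ** F j) \<and> zero_on V (Fs i ** B ** Fs j)) \<and>
        (\<bar>int i - int j\<bar> = 1 \<longrightarrow> \<not> zero_on V (F i ** Bs ** F j) \<and> \<not> zero_on V (Fs i ** B ** Fs j)))"

definition eigenvalue_sequence ::
    "(complex ^ 'v) set \<Rightarrow> nat \<Rightarrow> complex ^ 'v ^ 'v::finite \<Rightarrow> (nat \<Rightarrow> complex ^ 'v ^ 'v) \<Rightarrow>
     (nat \<Rightarrow> complex) \<Rightarrow> bool" where
  "eigenvalue_sequence V n B F \<theta> \<longleftrightarrow> (\<forall>i\<le>n. zero_on V (B ** F i - \<theta> i *k F i))"

definition indexed_basis :: "(complex ^ 'v::finite) set \<Rightarrow> nat \<Rightarrow> (nat \<Rightarrow> complex ^ 'v) \<Rightarrow> bool" where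
  "indexed_basis V n u \<longleftrightarrow>
     inj_on u {..n} \<and> vec.independent (u ` {..n}) \<and> vec.span (u ` {..n}) = V"

text \<open>\<open>M i j\<close> (\<open>0 \<le> i, j \<le> n\<close>) are the entries of the matrix representing \<open>B\<close> in the basis \<open>u\<close>.\<close>

definition represented_by ::
    "nat \<Rightarrow> (nat \<Rightarrow> complex ^ 'v) \<Rightarrow> complex ^ 'v ^ 'v::finite \<Rightarrow> (nat \<Rightarrow> nat \<Rightarrow> complex) \<Rightarrow> bool" where
  "represented_by n u B M \<longleftrightarrow> (\<forall>j\<le>n. B *v u j = (\<Sum>i\<le>n. M i j *s u i))"

definition lower_bidiagonal :: "(nat \<Rightarrow> complex) \<Rightarrow> nat \<Rightarrow> nat \<Rightarrow> complex" where
  "lower_bidiagonal \<theta> i j = (if i = j then \<theta> i else if i = j + 1 then 1 else 0)"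

definition upper_bidiagonal :: "(nat \<Rightarrow> complex) \<Rightarrow> (nat \<Rightarrow> complex) \<Rightarrow> nat \<Rightarrow> nat \<Rightarrow> complex" where
  "upper_bidiagonal \<theta> \<phi> i j = (if i = j then \<theta> i else if j = i + 1 then \<phi> j else 0)"

text \<open>Split sequences are indexed by \<open>1, \<dots>, n\<close>.\<close>

definition first_split_sequence ::
    "(complex ^ 'v) set \<Rightarrow> nat \<Rightarrow> complex ^ 'v ^ 'v::finite \<Rightarrow> complex ^ 'v ^ 'v \<Rightarrow>
     (nat \<Rightarrow> complex ^ 'v ^ 'v) \<Rightarrow> (nat \<Rightarrow> complex ^ 'v ^ 'v) \<Rightarrow> (nat \<Rightarrow> complex) \<Rightarrow> bool" where
  "first_split_sequence V n B Bs F Fs \<phi> \<longleftrightarrow>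
     (\<forall>i\<in>{1..n}. \<phi> i \<noteq> 0) \<and>
     (\<exists>\<theta> \<theta>s u. eigenvalue_sequence V n B F \<theta> \<and> eigenvalue_sequence V n Bs Fs \<theta>s \<and>
        indexed_basis V n u \<and>
        represented_by n u B (lower_bidiagonal \<theta>) \<and>
        represented_by n u Bs (upper_bidiagonal \<theta>s \<phi>))"

definition second_split_sequence ::
    "(complex ^ 'v) set \<Rightarrow> nat \<Rightarrow> complex ^ 'v ^ 'v::finite \<Rightarrow> complex ^ 'v ^ 'v \<Rightarrow>
     (nat \<Rightarrow> complex ^ 'v ^ 'v) \<Rightarrow> (nat \<Rightarrow> complex ^ 'v ^ 'v) \<Rightarrow> (nat \<Rightarrow> complex) \<Rightarrow> bool" where
  "second_split_sequence V n B Bs F Fs \<psi> \<longleftrightarrow>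
     first_split_sequence V n B Bs (\<lambda>i. F (n - i)) Fs \<psi>"

text \<open>Here and below \<open>\<phi>\<close> is the first and \<open>\<psi>\<close> the second split sequence.\<close>

definition parameter_array ::
    "(complex ^ 'v) set \<Rightarrow> nat \<Rightarrow> complex ^ 'v ^ 'v::finite \<Rightarrow> complex ^ 'v ^ 'v \<Rightarrow>
     (nat \<Rightarrow> complex ^ 'v ^ 'v) \<Rightarrow> (nat \<Rightarrow> complex ^ 'v ^ 'v) \<Rightarrow>
     (nat \<Rightarrow> complex) \<Rightarrow> (nat \<Rightarrow> complex) \<Rightarrow> (nat \<Rightarrow> complex) \<Rightarrow> (nat \<Rightarrow> complex) \<Rightarrow> bool" where
  "parameter_array V n B Bs F Fs \<theta> \<theta>s \<phi> \<psi> \<longleftrightarrow>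
     eigenvalue_sequence V n B F \<theta> \<and> eigenvalue_sequence V n Bs Fs \<theta>s \<and>
     first_split_sequence V n B Bs F Fs \<phi> \<and> second_split_sequence V n B Bs F Fs \<psi>"

definition q_racah_array ::
    "nat \<Rightarrow> complex \<Rightarrow> complex \<Rightarrow> complex \<Rightarrow> complex \<Rightarrow> complex \<Rightarrow> complex \<Rightarrow> complex \<Rightarrow>
     (nat \<Rightarrow> complex) \<Rightarrow> (nat \<Rightarrow> complex) \<Rightarrow> (nat \<Rightarrow> complex) \<Rightarrow> (nat \<Rightarrow> complex) \<Rightarrow> bool" where
  "q_racah_array d q h hs s ss r1 r2 \<theta> \<theta>s \<phi> \<psi> \<longleftrightarrow>
     h \<noteq> 0 \<and> hs \<noteq> 0 \<and> s \<noteq> 0 \<and> ss \<noteq> 0 \<and> r1 \<noteq> 0 \<and> r2 \<noteq> 0 \<and>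
     r1 * r2 = s * ss * q ^ (d + 1) \<and>
     (\<forall>i\<in>{1..d}. q ^ i \<noteq> 1 \<and> r1 * q ^ i \<noteq> 1 \<and> r2 * q ^ i \<noteq> 1 \<and>
        ss * q ^ i / r1 \<noteq> 1 \<and> ss * q ^ i / r2 \<noteq> 1) \<and>
     (\<forall>i\<in>{2..2 * d}. s * q ^ i \<noteq> 1 \<and> ss * q ^ i \<noteq> 1) \<and>
     (\<forall>i\<le>d. \<theta> i = \<theta> 0 + h * (1 - q ^ i) * (1 - s * q ^ (i + 1)) * q powi (- int i)) \<and>
     (\<forall>i\<le>d. \<theta>s i = \<theta>s 0 + hs * (1 - q ^ i) * (1 - ss * q ^ (i + 1)) * q powi (- int i)) \<and>
     (\<forall>i\<in>{1..d}. \<phi> i = h * hs * q powi (1 - 2 * int i) * (1 - q ^ i) *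
        (1 - q powi (int i - int d - 1)) * (1 - r1 * q ^ i) * (1 - r2 * q ^ i)) \<and>
     (\<forall>i\<in>{1..d}. \<psi> i = h * hs * q powi (1 - 2 * int i) * (1 - q ^ i) *
        (1 - q powi (int i - int d - 1)) * (r1 - ss * q ^ i) * (r2 - ss * q ^ i) / ss)"


section \<open>Delsarte cliques and the cells\<close>

definition delsarte_clique :: "('v::finite \<Rightarrow> 'v \<Rightarrow> bool) \<Rightarrow> real \<Rightarrow> 'v set \<Rightarrow> bool" where
  "delsarte_clique adj \<theta>min C \<longleftrightarrow>
     C \<noteq> {} \<and> (\<forall>y\<in>C. \<forall>z\<in>C. y \<noteq> z \<longrightarrow> adj y z) \<and>
     real (card C) = 1 - real (valency adj) / \<theta>min"

definition setdist_graph :: "('v::finite \<Rightarrow> 'v \<Rightarrow> bool) \<Rightarrow> 'v \<Rightarrow> 'v set \<Rightarrow> nat" where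
  "setdist_graph adj y C = Min (gdist adj y ` C)"

definition clique_layer :: "('v::finite \<Rightarrow> 'v \<Rightarrow> bool) \<Rightarrow> 'v set \<Rightarrow> nat \<Rightarrow> 'v set" where
  "clique_layer adj C i = {y. setdist_graph adj y C = i}"

definition cell_minus :: "('v::finite \<Rightarrow> 'v \<Rightarrow> bool) \<Rightarrow> 'v set \<Rightarrow> 'v \<Rightarrow> nat \<Rightarrow> 'v set" where
  "cell_minus adj C x i = clique_layer adj C i \<inter> gsphere adj i x"

definition cell_plus :: "('v::finite \<Rightarrow> 'v \<Rightarrow> bool) \<Rightarrow> 'v set \<Rightarrow> 'v \<Rightarrow> nat \<Rightarrow> 'v set" where
  "cell_plus adj C x i = clique_layer adj C i \<inter> gsphere adj (i + 1) x"

definition equitable_partition :: "('v::finite \<Rightarrow> 'v \<Rightarrow> bool) \<Rightarrow> 'v set set \<Rightarrow> bool" where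
  "equitable_partition adj \<P> \<longleftrightarrow>
     partition_on UNIV \<P> \<and>
     (\<forall>P\<in>\<P>. \<forall>Q\<in>\<P>. \<exists>n. \<forall>z\<in>P. card (gsphere adj 1 z \<inter> Q) = n)"

end

theory Submission
  imports Defs
begin

text \<open>
  The layers \<open>C\<^sub>j\<close> of the clique and the spheres around \<open>x\<close> are unions
  of consecutive cells in the sequence \<open>C\<^sub>0\<^sup>-, C\<^sub>0\<^sup>+, C\<^sub>1\<^sup>-, C\<^sub>1\<^sup>+, \<dots>\<close>: a layer is a minus cell
  followed by the plus cell of the same index, and a sphere of positive radius is a plus cell
  followed by the next minus cell. For a vertex \<open>z\<close>, the numbers of its neighbours in the spheres
  depend only on its distance to \<open>x\<close>, by distance-regularity. If the numbers of its neighbours in the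
  layers depend only on its distance to \<open>C\<close>, then successive subtraction shows that the numbers of
  its neighbours in the cells depend only on its own cell (lemma \<open>cell_count_cong\<close>). So the
  statement reduces to the classical fact that a Delsarte clique is completely regular with covering
  radius \<open>d - 1\<close>, and to the nonemptiness of the cells.

  Complete regularity follows from a function \<open>u\<close> of the distance whose matrix
  \<open>u (gdist adj y z)\<close> is a scalar multiple of the projection onto the eigenspace of the least
  eigenvalue \<open>\<theta> d\<close>. The size of a Delsarte clique makes the indicator vector of \<open>C\<close> orthogonal to
  this eigenspace (\<open>delsarte_clique_sum_zero\<close>), so the sum of \<open>u (gdist adj y c)\<close> over \<open>c\<close> in \<open>C\<close> is
  zero for every \<open>y\<close>. Only the distances \<open>i\<close> and \<open>i + 1\<close> occur if \<open>y\<close> is in \<open>C\<^sub>i\<close>. Because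
  \<open>\<theta> d\<close> is least, the values of \<open>u\<close> are nonzero and alternate in sign
  (\<open>radial_eigenfunction_least\<close>), so the number of vertices of \<open>C\<close> at distance \<open>i\<close> from \<open>y\<close> depends
  only on \<open>i\<close> and is less than \<open>card C\<close>. Counting pairs of a neighbour of \<open>y\<close> and a
  clique vertex then gives the numbers of neighbours of \<open>y\<close> in the layers (\<open>layer_count_cong\<close>).

  That \<open>\<theta> d\<close> is the least eigenvalue is read off from the expansion of the adjacency matrix in
  primitive idempotents: these are mutually orthogonal because the Bose-Mesner algebra is commutative,
  so every nonzero eigenvalue is one of the \<open>\<theta> i\<close>, and the least one is negative.
\<close>

section \<open>Symmetric real matrices\<close>

lemma inner_symmetric_matrix:
  fixes M :: "real ^ 'n ^ 'n"
  assumes "transpose M = M"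
  shows "(M *v x) \<bullet> y = x \<bullet> (M *v y)"
  using dot_lmul_matrix[of x M y] transpose_matrix_vector[of M x] unfolding assms by simp

text \<open>
  If \<open>M - t\<close> is positive semidefinite, a vector on which its quadratic form vanishes is in its kernel.
\<close>

lemma rayleigh_equality_imp_eigenvector:
  fixes M :: "real ^ 'n ^ 'n"
  assumes sym: "transpose M = M"
    and lower: "\<And>v. t * (v \<bullet> v) \<le> v \<bullet> (M *v v)"
    and eq: "w \<bullet> (M *v w) = t * (w \<bullet> w)"
  shows "M *v w = t *\<^sub>R w"
proof (rule ccontr)
  assume ne: "M *v w \<noteq> t *\<^sub>R w"
  define z where "z = M *v w - t *\<^sub>R w"
  define p where "p = z \<bullet> z"
  define c where "c = z \<bullet> (M *v z) - t * p"
  have p: "p > 0" using ne by (simp add: p_def z_def)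
  have c: "c \<ge> 0" using lower[of z] by (simp add: c_def p_def)
  have wz: "w \<bullet> (M *v z) = (M *v w) \<bullet> z"
    using inner_symmetric_matrix[OF sym, of w z] by simp
  \<comment> \<open>this \<open>s\<close> minimises \<open>2 s p + s\<^sup>2 (c + 1)\<close>; the summand 1 avoids a division by zero if \<open>c = 0\<close>\<close>
  define s where "s = - p / (c + 1)"
  have Mv: "M *v (w + s *\<^sub>R z) = M *v w + s *\<^sub>R (M *v z)"
    by (simp add: matrix_vector_right_distrib matrix_vector_mult_scaleR)
  have zp: "(M *v w) \<bullet> z - t * (w \<bullet> z) = p"
    by (simp add: p_def z_def inner_diff_left)
  have 1: "(w + s *\<^sub>R z) \<bullet> (M *v (w + s *\<^sub>R z))
      = w \<bullet> (M *v w) + s * (w \<bullet> (M *v z)) + s * (z \<bullet> (M *v w)) + s\<^sup>2 * (z \<bullet> (M *v z))"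
    unfolding Mv by (simp add: inner_add_left inner_add_right power2_eq_square distrib_left)
  have 2: "(w + s *\<^sub>R z) \<bullet> (w + s *\<^sub>R z) = w \<bullet> w + 2 * s * (w \<bullet> z) + s\<^sup>2 * (z \<bullet> z)"
    by (simp add: inner_add_left inner_add_right power2_eq_square distrib_left inner_commute)
  have "(w + s *\<^sub>R z) \<bullet> (M *v (w + s *\<^sub>R z)) - t * ((w + s *\<^sub>R z) \<bullet> (w + s *\<^sub>R z))
      = (w \<bullet> (M *v w) - t * (w \<bullet> w)) + 2 * s * ((M *v w) \<bullet> z - t * (w \<bullet> z)) + s\<^sup>2 * c"
    unfolding 1 2 wz inner_commute[of z "M *v w"] c_def p_def
    by (simp add: right_diff_distrib distrib_left)
  also have "\<dots> = 2 * s * p + s\<^sup>2 * c" using eq zp by simp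
  finally have "2 * s * p + s\<^sup>2 * c \<ge> 0" using lower[of "w + s *\<^sub>R z"] by simp
  moreover have sc: "s * (c + 1) = - p" using c by (simp add: s_def)
  have "s\<^sup>2 * c = - p * s - s\<^sup>2"
  proof -
    have "s\<^sup>2 * c = s * (s * (c + 1)) - s\<^sup>2" by (simp add: power2_eq_square algebra_simps)
    then show ?thesis unfolding sc by simp
  qed
  moreover have "s < 0" using p c by (simp add: s_def)
  ultimately have "s * p - s\<^sup>2 \<ge> 0" by (simp add: algebra_simps)
  moreover have "s * p < 0" using \<open>s < 0\<close> p by (simp add: mult_neg_pos)
  ultimately show False using zero_le_power2[of s] by linarith
qed

lemma symmetric_min_eigenvector:
  fixes M :: "real ^ 'n ^ 'n"
  assumes sym: "transpose M = M"
  obtains \<mu> w where "w \<noteq> 0" "M *v w = \<mu> *\<^sub>R w" "\<And>v. \<mu> * (v \<bullet> v) \<le> v \<bullet> (M *v v)"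
proof -
  have "\<exists>w\<in>sphere 0 1. \<forall>v\<in>sphere 0 1. w \<bullet> (M *v w) \<le> v \<bullet> (M *v v)"
    by (rule continuous_attains_inf)
      (simp_all add: continuous_on_inner matrix_vector_mult_linear_continuous_on)
  then obtain w :: "real ^ 'n" where w: "norm w = 1"
    and min: "\<And>v. norm v = 1 \<Longrightarrow> w \<bullet> (M *v w) \<le> v \<bullet> (M *v v)" by auto
  define \<mu> where "\<mu> = w \<bullet> (M *v w)"
  have lower: "\<mu> * (v \<bullet> v) \<le> v \<bullet> (M *v v)" for v
  proof (cases "v = 0")
    case False
    then have "\<mu> \<le> (v /\<^sub>R norm v) \<bullet> (M *v (v /\<^sub>R norm v))"
      unfolding \<mu>_def by (intro min) simp
    also have "\<dots> = (v \<bullet> (M *v v)) / (norm v)\<^sup>2"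
      by (simp add: matrix_vector_mult_scaleR power2_eq_square divide_inverse)
    finally show ?thesis using False
      by (simp add: pos_le_divide_eq power2_norm_eq_inner)
  qed simp
  have "w \<bullet> w = 1" using w by (simp add: norm_eq_1)
  then have "M *v w = \<mu> *\<^sub>R w"
    by (intro rayleigh_equality_imp_eigenvector[OF sym lower]) (simp add: \<mu>_def)
  then show thesis using w lower by (intro that[of w \<mu>]) auto
qed

section \<open>Graph distance\<close>

locale connected_simple_graph =
  fixes adj :: "'v::finite \<Rightarrow> 'v \<Rightarrow> bool"
  assumes simple: "simple_graph adj"
    and connected: "connected_graph adj"
begin

lemma adj_sym: "adj y z \<longleftrightarrow> adj z y"
  using simple by (auto simp: simple_graph_def)

lemma not_adj_self [simp]: "\<not> adj y y"
  using simple by (auto simp: simple_graph_def)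

lemma walk_sym: "(adj ^^ n) y z \<Longrightarrow> (adj ^^ n) z y"
proof (induction n arbitrary: z)
  case (Suc n)
  then obtain w where "(adj ^^ n) y w" "adj w z" by (elim relpowp_Suc_E)
  then show ?case using Suc.IH adj_sym by (metis relpowp_Suc_I2)
qed auto

lemma gdist_walk: "(adj ^^ gdist adj y z) y z"
proof -
  have "\<exists>n. (adj ^^ n) y z"
    using connected by (simp add: connected_graph_def rtranclp_power)
  then show ?thesis unfolding gdist_def by (rule LeastI_ex)
qed

lemma gdist_le: "(adj ^^ n) y z \<Longrightarrow> gdist adj y z \<le> n"
  unfolding gdist_def by (rule Least_le)

lemma gdist_sym: "gdist adj y z = gdist adj z y"
  by (meson antisym gdist_le gdist_walk walk_sym)

lemma gdist_triangle: "gdist adj y z \<le> gdist adj y w + gdist adj w z"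
proof -
  have "(adj ^^ (gdist adj y w + gdist adj w z)) y z"
    unfolding relpowp_add using gdist_walk by blast
  then show ?thesis by (rule gdist_le)
qed

lemma gdist_eq_0_iff [simp]: "gdist adj y z = 0 \<longleftrightarrow> y = z"
proof
  assume "gdist adj y z = 0"
  then show "y = z" using gdist_walk[of y z] by simp
next
  assume "y = z"
  then have "(adj ^^ 0) y z" by simp
  then show "gdist adj y z = 0" using gdist_le by fastforce
qed

lemma gdist_self [simp]: "gdist adj y y = 0"
  by simp

lemma gdist_eq_1_iff: "gdist adj y z = 1 \<longleftrightarrow> adj y z"
proof
  assume "gdist adj y z = 1"
  then show "adj y z" using gdist_walk[of y z] by (simp only: relpowp_1)
next
  assume a: "adj y z"
  then have "gdist adj y z \<le> 1" by (intro gdist_le) (simp only: relpowp_1)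
  moreover have "gdist adj y z \<noteq> 0" using a by auto
  ultimately show "gdist adj y z = 1" by linarith
qed

lemma gdist_adj_le: "adj y z \<Longrightarrow> gdist adj x z \<le> gdist adj x y + 1"
  using gdist_triangle[of x z y] gdist_eq_1_iff[of y z] by simp

lemma gdist_geodesic:
  assumes "i \<le> gdist adj y z"
  obtains w where "gdist adj y w = i" "gdist adj w z = gdist adj y z - i"
proof -
  have "(adj ^^ (i + (gdist adj y z - i))) y z" using assms gdist_walk by simp
  then obtain w where "(adj ^^ i) y w" "(adj ^^ (gdist adj y z - i)) w z"
    unfolding relpowp_add by auto
  then have "gdist adj y w \<le> i" "gdist adj w z \<le> gdist adj y z - i" by (auto dest: gdist_le)
  with gdist_triangle[of y z w] assms show thesis by (intro that[of w]) linarith+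
qed

lemma gsphere_1: "gsphere adj 1 y = {z. adj y z}"
  by (simp only: gsphere_def gdist_eq_1_iff)

lemma gdist_le_diameter: "gdist adj y z \<le> graph_diameter adj"
proof -
  have "{gdist adj y z | y z. True} = (\<lambda>(y, z). gdist adj y z) ` UNIV" by auto
  then have "finite {gdist adj y z | y z. True}" by simp
  then show ?thesis unfolding graph_diameter_def by (rule Max_ge) auto
qed

end

section \<open>The Bose-Mesner algebra\<close>

lemma mat_scale_component [simp]: "(c *k M) $ i $ j = c * M $ i $ j"
  by (simp add: mat_scale_def)

lemma mat_scale_mult_vector: "(c *k M) *v v = c *s (M *v v)"
  by (simp add: vec_eq_iff matrix_vector_mult_def sum_distrib_left mult.assoc)

lemma sum_mat_scale_mult_vector:
  fixes M :: "'i \<Rightarrow> complex ^ 'n ^ 'm"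
  shows "(\<Sum>i\<in>I. c i *k M i) *v v = (\<Sum>i\<in>I. c i *s (M i *v v))"
  by (induction I rule: infinite_finite_induct)
    (simp_all add: matrix_vector_mult_add_rdistrib mat_scale_mult_vector)

lemma matrix_mult_vector_sum_scale:
  fixes M :: "complex ^ 'n ^ 'm"
  shows "M *v (\<Sum>i\<in>I. c i *s v i) = (\<Sum>i\<in>I. c i *s (M *v v i))"
  by (induction I rule: infinite_finite_induct)
    (simp_all add: matrix_vector_right_distrib vector_scalar_commute)

lemma matrix_mult_axis_component:
  fixes M :: "complex ^ 'n::finite ^ 'm"
  shows "(M *v axis j 1) $ i = M $ i $ j"
  by (simp add: matrix_vector_mult_def axis_def if_distrib cong: if_cong)

locale distance_regular_graph = connected_simple_graph adj
  for adj :: "'v::finite \<Rightarrow> 'v \<Rightarrow> bool" +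
  assumes distance_regular: "distance_regular adj"
begin

lemma card_gsphere_Int_cong:
  "gdist adj y z = gdist adj y' z' \<Longrightarrow>
     card (gsphere adj i y \<inter> gsphere adj j z) = card (gsphere adj i y' \<inter> gsphere adj j z')"
  using distance_regular unfolding distance_regular_def by metis

lemma card_gsphere_cong: "card (gsphere adj i y) = card (gsphere adj i z)"
  using card_gsphere_Int_cong[of y y z z i i] by simp

lemma gdist_diameter_attained: "\<exists>w. gdist adj x w = graph_diameter adj"
proof -
  have "{gdist adj y z | y z. True} = (\<lambda>(y, z). gdist adj y z) ` UNIV" by auto
  then have "finite {gdist adj y z | y z. True}" by simp
  then have "graph_diameter adj \<in> {gdist adj y z | y z. True}"
    unfolding graph_diameter_def by (intro Max_in) auto
  then obtain y z where "gdist adj y z = graph_diameter adj" by auto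
  then have "card (gsphere adj (graph_diameter adj) y) > 0"
    by (auto simp: card_gt_0_iff gsphere_def)
  then have "card (gsphere adj (graph_diameter adj) x) > 0"
    by (simp add: card_gsphere_cong[of _ x y])
  then show ?thesis by (auto simp: card_gt_0_iff gsphere_def)
qed

lemma valency_eq: "valency adj = card {z. adj y z}"
proof -
  let ?P = "\<lambda>n. \<forall>y z. gdist adj y z = 0 \<longrightarrow> card (gsphere adj 1 y \<inter> gsphere adj 1 z) = n"
  have "(THE n. ?P n) = card (gsphere adj 1 y)"
  proof (rule the_equality)
    show "?P (card (gsphere adj 1 y))" using card_gsphere_cong by simp
    show "n = card (gsphere adj 1 y)" if "?P n" for n
      using that by (metis gdist_self inf.idem)
  qed
  then show ?thesis
    unfolding valency_def b_number_def intersection_number_def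
    by (simp add: gsphere_1[of y, unfolded One_nat_def])
qed

text \<open>
  A sum over all vertices of a function of the distances to \<open>y\<close> and \<open>z\<close> is a combination of
  intersection numbers \<open>p\<^sup>h\<^sub>i\<^sub>j\<close> with \<open>h = gdist adj y z\<close>, with coefficients that depend only on
  the function.
\<close>

lemma sum_over_distances_cong:
  fixes F :: "nat \<Rightarrow> nat \<Rightarrow> 'a::comm_semiring_1"
  assumes "gdist adj y z = gdist adj y' z'"
  shows "(\<Sum>w\<in>UNIV. F (gdist adj y w) (gdist adj z w)) =
         (\<Sum>w\<in>UNIV. F (gdist adj y' w) (gdist adj z' w))"
proof -
  let ?T = "{..graph_diameter adj} \<times> {..graph_diameter adj}"
  have *: "(\<Sum>w\<in>UNIV. F (gdist adj y w) (gdist adj z w)) =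
      (\<Sum>p\<in>?T. of_nat (card (gsphere adj (fst p) y \<inter> gsphere adj (snd p) z)) * F (fst p) (snd p))"
    for y z
  proof -
    have "(\<Sum>w\<in>UNIV. F (gdist adj y w) (gdist adj z w)) =
        (\<Sum>p\<in>?T. \<Sum>w | w \<in> UNIV \<and> (gdist adj y w, gdist adj z w) = p.
           F (gdist adj y w) (gdist adj z w))"
      by (rule sum.group[symmetric]) (auto simp: gdist_le_diameter)
    also have "\<dots> = (\<Sum>p\<in>?T. \<Sum>w\<in>gsphere adj (fst p) y \<inter> gsphere adj (snd p) z.
        F (fst p) (snd p))"
      by (intro sum.cong refl) (auto simp: gsphere_def)
    finally show ?thesis by simp
  qed
  show ?thesis
    unfolding * using card_gsphere_Int_cong[OF assms] by simp
qed

lemma function_of_distance: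
  assumes "\<And>y z y' z'. gdist adj y z = gdist adj y' z' \<Longrightarrow> F y z = F y' z'"
  obtains f where "\<And>y z. F y z = f (gdist adj y z)"
proof -
  define p where "p i = (SOME p. gdist adj (fst p) (snd p) = i)" for i
  have "gdist adj (fst (p (gdist adj y z))) (snd (p (gdist adj y z))) = gdist adj y z" for y z
    unfolding p_def by (rule someI[of _ "(y, z)"]) simp
  then show thesis
    using assms by (intro that[of "\<lambda>i. F (fst (p i)) (snd (p i))"]) metis
qed

text \<open>
  A matrix is radial if its entries depend only on the distance between row and column index,
  that is, if it is a linear combination of distance matrices.
\<close>

definition radial :: "complex ^ 'v ^ 'v \<Rightarrow> bool" where
  "radial M \<longleftrightarrow> (\<exists>f. \<forall>y z. M $ y $ z = f (gdist adj y z))"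

lemma radial_mult:
  assumes "radial M" "radial N"
  shows "radial (M ** N)"
proof -
  obtain f g where f: "\<And>y z. M $ y $ z = f (gdist adj y z)" and g: "\<And>y z. N $ y $ z = g (gdist adj z y)"
    using assms gdist_sym unfolding radial_def by metis
  have "(M ** N) $ y $ z = (M ** N) $ y' $ z'" if "gdist adj y z = gdist adj y' z'" for y z y' z'
    using sum_over_distances_cong[OF that, of "\<lambda>i j. f i * g j"]
    by (simp add: matrix_matrix_mult_def f g)
  from function_of_distance[of "\<lambda>y z. (M ** N) $ y $ z", OF this] show ?thesis
    unfolding radial_def by metis
qed

lemma radial_bose_mesner: "M \<in> bose_mesner adj \<Longrightarrow> radial M"
  unfolding bose_mesner_def
proof (induction rule: generated_algebra.induct)
  case one
  then show ?case unfolding radial_def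
    by (intro exI[of _ "\<lambda>i. if i = 0 then 1 else 0"]) (simp add: mat_def)
next
  case gen
  then show ?case unfolding radial_def
    by (intro exI[of _ "\<lambda>i. if i = 1 then 1 else 0"]) (simp add: adjacency_matrix_def)
next
  case (add P Q)
  then obtain f g where "\<And>y z. P $ y $ z = f (gdist adj y z)" "\<And>y z. Q $ y $ z = g (gdist adj y z)"
    unfolding radial_def by metis
  then show ?case unfolding radial_def by (intro exI[of _ "\<lambda>i. f i + g i"]) simp
next
  case (scale P c)
  then obtain f where "\<And>y z. P $ y $ z = f (gdist adj y z)" unfolding radial_def by metis
  then show ?case unfolding radial_def by (intro exI[of _ "\<lambda>i. c * f i"]) simp
next
  case (mult P Q)
  then show ?case by (intro radial_mult)
qed

lemma radial_transpose: "radial M \<Longrightarrow> transpose M = M"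
  unfolding radial_def by (auto simp: vec_eq_iff transpose_def gdist_sym)

text \<open>Radial matrices are symmetric and closed under multiplication, hence they commute.\<close>

lemma bose_mesner_commute:
  assumes "M \<in> bose_mesner adj" "N \<in> bose_mesner adj"
  shows "M ** N = N ** M"
  using assms
  by (metis matrix_transpose_mul radial_bose_mesner radial_mult radial_transpose)

lemma bose_mesner_mult: "M \<in> bose_mesner adj \<Longrightarrow> N \<in> bose_mesner adj \<Longrightarrow> M ** N \<in> bose_mesner adj"
  unfolding bose_mesner_def by (rule generated_algebra.mult)

lemma bose_mesner_diff:
  assumes "M \<in> bose_mesner adj" "N \<in> bose_mesner adj"
  shows "M - N \<in> bose_mesner adj"
proof -
  have "M - N = M + (-1) *k N" by (simp add: vec_eq_iff)
  then show ?thesis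
    using assms unfolding bose_mesner_def
    by (metis generated_algebra.add generated_algebra.scale)
qed

text \<open>Otherwise \<open>e = e ** f + (e - e ** f)\<close> would be a nontrivial orthogonal decomposition.\<close>

lemma primitive_idempotent_mult:
  assumes e: "e \<in> primitive_idempotents (bose_mesner adj)"
    and f: "f \<in> bose_mesner adj" "f ** f = f"
  shows "e ** f = 0 \<or> e ** f = e"
proof -
  have eR: "e \<in> bose_mesner adj" and ee: "e ** e = e"
    using e by (auto simp: primitive_idempotents_def)
  define g where "g = e ** f"
  have fe: "f ** e = g" using bose_mesner_commute[OF f(1) eR] by (simp add: g_def)
  have gR: "g \<in> bose_mesner adj" "e - g \<in> bose_mesner adj"
    unfolding g_def using eR f bose_mesner_mult bose_mesner_diff by blast+
  have eg: "e ** g = g" unfolding g_def by (simp add: matrix_mul_assoc ee)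
  have ge: "g ** e = g" using bose_mesner_commute[OF gR(1) eR] eg by simp
  have gg: "g ** g = g"
    by (metis fe eg f(2) g_def matrix_mul_assoc)
  have sub: "A ** (B - D) = A ** B - A ** D" "(B - D) ** A = B ** A - D ** A"
    for A B D :: "complex ^ 'v ^ 'v"
    by (simp_all add: vec_eq_iff matrix_matrix_mult_def sum_subtractf algebra_simps)
  have "(e - g) ** (e - g) = e - g" "g ** (e - g) = 0" "(e - g) ** g = 0" "e = g + (e - g)"
    by (simp_all add: sub ee eg ge gg)
  with e gR gg have "g = 0 \<or> e - g = 0"
    unfolding primitive_idempotents_def by blast
  then show ?thesis by (auto simp: g_def)
qed

lemma primitive_idempotents_orthogonal:
  assumes "e \<in> primitive_idempotents (bose_mesner adj)"
    and "f \<in> primitive_idempotents (bose_mesner adj)" and "e \<noteq> f"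
  shows "e ** f = 0"
proof -
  have "e \<in> bose_mesner adj" "e ** e = e" "f \<in> bose_mesner adj" "f ** f = f"
    using assms by (auto simp: primitive_idempotents_def)
  then show ?thesis
    using primitive_idempotent_mult[OF assms(1), of f] primitive_idempotent_mult[OF assms(2), of e]
      bose_mesner_commute[of e f] assms(3) by metis
qed

end

section \<open>The least eigenvalue\<close>

context connected_simple_graph
begin

text \<open>The adjacency matrix over the reals, where the quadratic form can be compared.\<close>

definition real_adjacency :: "real ^ 'v ^ 'v" where
  "real_adjacency = (\<chi> y z. if adj y z then 1 else 0)"

lemma real_adjacency_symmetric: "transpose real_adjacency = real_adjacency"
  by (simp add: real_adjacency_def transpose_def vec_eq_iff adj_sym)

lemma real_adjacency_mult: "(real_adjacency *v v) $ y = (\<Sum>z | adj y z. v $ z)"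
proof -
  have "(real_adjacency *v v) $ y = (\<Sum>z\<in>UNIV. if adj y z then v $ z else 0)"
    unfolding real_adjacency_def matrix_vector_mult_def by (simp, intro sum.cong) auto
  then show ?thesis by (simp add: sum.inter_filter[symmetric])
qed

lemma adjacency_matrix_mult: "(adjacency_matrix adj *v v) $ y = (\<Sum>z | adj y z. v $ z)"
proof -
  have "(adjacency_matrix adj *v v) $ y = (\<Sum>z\<in>UNIV. if adj y z then v $ z else 0)"
    unfolding adjacency_matrix_def matrix_vector_mult_def gdist_eq_1_iff
    by (simp, intro sum.cong) auto
  then show ?thesis by (simp add: sum.inter_filter[symmetric])
qed

text \<open>
  \<open>u\<close> is a radial eigenfunction for \<open>t\<close> if, for every \<open>x\<close>, the vector with entries
  \<open>u (gdist adj x y)\<close> is multiplied by \<open>t\<close> by the adjacency matrix. The vector may be zero.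
\<close>

definition radial_eigenfunction :: "(nat \<Rightarrow> real) \<Rightarrow> real \<Rightarrow> bool" where
  "radial_eigenfunction u t \<longleftrightarrow>
     (\<forall>x y. (\<Sum>z | adj y z. u (gdist adj x z)) = t * u (gdist adj x y))"

end

context distance_regular_graph
begin

context
  fixes d :: nat and E :: "nat \<Rightarrow> complex ^ 'v ^ 'v" and \<theta> :: "nat \<Rightarrow> real"
  assumes E: "bij_betw E {..d} (primitive_idempotents (bose_mesner adj))"
    and A: "adjacency_matrix adj = (\<Sum>i\<le>d. complex_of_real (\<theta> i) *k E i)"
begin

lemma idempotent_product:
  assumes "i \<le> d" "j \<le> d"
  shows "E i ** E j = (if i = j then E i else 0)"
proof -
  have mem: "E i \<in> primitive_idempotents (bose_mesner adj)" "E j \<in> primitive_idempotents (bose_mesner adj)"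
    using E assms by (auto simp: bij_betw_def)
  show ?thesis
  proof (cases "i = j")
    case True
    then show ?thesis using mem by (simp add: primitive_idempotents_def)
  next
    case False
    then have "E i \<noteq> E j" using E assms by (auto simp: bij_betw_def inj_on_def)
    then show ?thesis using primitive_idempotents_orthogonal[OF mem] False by simp
  qed
qed

lemma adjacency_matrix_expand:
  "adjacency_matrix adj *v v = (\<Sum>i\<le>d. complex_of_real (\<theta> i) *s (E i *v v))"
  unfolding A by (rule sum_mat_scale_mult_vector)

lemma adjacency_matrix_idempotent:
  assumes i: "i \<le> d"
  shows "adjacency_matrix adj *v (E i *v v) = complex_of_real (\<theta> i) *s (E i *v v)"
proof -
  have "adjacency_matrix adj *v (E i *v v) =
      (\<Sum>j\<le>d. if j = i then complex_of_real (\<theta> i) *s (E i *v v) else 0)"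
    unfolding adjacency_matrix_expand
    by (intro sum.cong refl) (use i in \<open>auto simp: matrix_vector_mul_assoc idempotent_product\<close>)
  then show ?thesis using i by simp
qed

lemma idempotent_adjacency_matrix:
  assumes i: "i \<le> d"
  shows "E i *v (adjacency_matrix adj *v v) = complex_of_real (\<theta> i) *s (E i *v v)"
proof -
  have "E i *v (adjacency_matrix adj *v v) =
      (\<Sum>j\<le>d. if j = i then complex_of_real (\<theta> i) *s (E i *v v) else 0)"
    unfolding adjacency_matrix_expand matrix_mult_vector_sum_scale
    by (intro sum.cong refl) (use i in \<open>auto simp: matrix_vector_mul_assoc idempotent_product\<close>)
  then show ?thesis using i by simp
qed

lemma real_eigenvalue_in_spectrum:
  assumes w: "w \<noteq> 0" "real_adjacency *v w = \<mu> *\<^sub>R w" and \<mu>: "\<mu> \<noteq> 0"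
  shows "\<exists>i\<le>d. \<mu> = \<theta> i"
proof (rule ccontr)
  assume "\<not> ?thesis"
  then have ne: "\<mu> \<noteq> \<theta> i" if "i \<le> d" for i using that by auto
  define v :: "complex ^ 'v" where "v = (\<chi> y. complex_of_real (w $ y))"
  have "(adjacency_matrix adj *v v) $ y = complex_of_real ((real_adjacency *v w) $ y)" for y
    unfolding adjacency_matrix_mult real_adjacency_mult by (simp add: v_def)
  then have eig: "adjacency_matrix adj *v v = complex_of_real \<mu> *s v"
    by (simp add: vec_eq_iff w v_def)
  have "E i *v v = 0" if i: "i \<le> d" for i
  proof -
    have "complex_of_real \<mu> *s (E i *v v) = complex_of_real (\<theta> i) *s (E i *v v)"
      using idempotent_adjacency_matrix[OF i, of v] unfolding eig vector_scalar_commute .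
    then show ?thesis using ne[OF i] by (auto simp: vec_eq_iff)
  qed
  then have "adjacency_matrix adj *v v = 0" unfolding adjacency_matrix_expand by simp
  then have "v = 0" using eig \<mu> by (auto simp: vec_eq_iff)
  then have "w = 0" by (auto simp: vec_eq_iff v_def)
  then show False using w by simp
qed

text \<open>
  The least eigenvalue of the adjacency matrix is negative because the difference of the indicator
  vectors of two adjacent vertices has Rayleigh quotient \<open>-1\<close>. Being nonzero, it
  occurs among the \<open>\<theta> i\<close>.
\<close>

lemma rayleigh_bound:
  assumes dec: "\<And>i j. i < j \<Longrightarrow> j \<le> d \<Longrightarrow> \<theta> i > \<theta> j"
    and yz: "adj y z"
  shows "\<theta> d < 0" and "\<theta> d * (v \<bullet> v) \<le> v \<bullet> (real_adjacency *v v)"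
proof -
  obtain \<mu> w where w: "w \<noteq> 0" "real_adjacency *v w = \<mu> *\<^sub>R w"
    and lower: "\<And>v. \<mu> * (v \<bullet> v) \<le> v \<bullet> (real_adjacency *v v)"
    using symmetric_min_eigenvector[OF real_adjacency_symmetric] by blast
  have ne: "y \<noteq> z" using yz by auto
  have col: "real_adjacency *v axis a 1 = (\<chi> b. if adj b a then 1 else 0)" for a
    by (simp add: matrix_vector_mult_basis column_def real_adjacency_def)
  define f :: "real ^ 'v" where "f = axis y 1 - axis z 1"
  have "f \<bullet> f = 2"
    using ne by (simp add: f_def inner_diff_left inner_diff_right inner_axis_axis)
  moreover have "f \<bullet> (real_adjacency *v f) = -2"
    using yz adj_sym[of y z]
    by (simp add: f_def matrix_vector_mult_diff_distrib inner_diff_left inner_diff_right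
        inner_axis' col)
  ultimately have "\<mu> < 0" using lower[of f] by simp
  then obtain i where i: "i \<le> d" "\<mu> = \<theta> i" using real_eigenvalue_in_spectrum[OF w] by auto
  have le: "\<theta> d \<le> \<mu>" using dec[of i d] i by (cases "i = d") auto
  then show "\<theta> d < 0" using \<open>\<mu> < 0\<close> by simp
  show "\<theta> d * (v \<bullet> v) \<le> v \<bullet> (real_adjacency *v v)"
    using lower[of v] mult_right_mono[OF le, of "v \<bullet> v"] by simp
qed

text \<open>The real or the imaginary part of the entries of \<open>E i\<close> is a nonzero radial eigenfunction.\<close>

lemma radial_eigenfunction_exists:
  assumes i: "i \<le> d"
  obtains u y z where "radial_eigenfunction u (\<theta> i)" "u (gdist adj y z) \<noteq> 0"
proof -
  have mem: "E i \<in> primitive_idempotents (bose_mesner adj)" using E i by (auto simp: bij_betw_def)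
  then have "radial (E i)" by (intro radial_bose_mesner) (simp add: primitive_idempotents_def)
  then obtain e where e: "\<And>y z. E i $ y $ z = e (gdist adj y z)" unfolding radial_def by auto
  have "E i \<noteq> 0" using mem by (simp add: primitive_idempotents_def)
  then obtain y z where nz: "e (gdist adj y z) \<noteq> 0" by (auto simp: vec_eq_iff e)
  have eig: "(\<Sum>z | adj y z. e (gdist adj x z)) = complex_of_real (\<theta> i) * e (gdist adj x y)" for x y
  proof -
    have "(\<Sum>z | adj y z. e (gdist adj z x)) = complex_of_real (\<theta> i) * e (gdist adj y x)"
      using arg_cong[OF adjacency_matrix_idempotent[OF i, of "axis x 1"], of "\<lambda>v. v $ y"]
      unfolding adjacency_matrix_mult by (simp add: matrix_mult_axis_component e)
    then show ?thesis by (simp add: gdist_sym[of x])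
  qed
  have "radial_eigenfunction (\<lambda>j. Re (e j)) (\<theta> i)" "radial_eigenfunction (\<lambda>j. Im (e j)) (\<theta> i)"
    unfolding radial_eigenfunction_def
    using arg_cong[OF eig, of Re] arg_cong[OF eig, of Im] by simp_all
  moreover have "Re (e (gdist adj y z)) \<noteq> 0 \<or> Im (e (gdist adj y z)) \<noteq> 0"
    using nz by (simp add: complex_eq_iff)
  ultimately show thesis using that by blast
qed

end
end

section \<open>Radial eigenfunctions for the least eigenvalue\<close>

context connected_simple_graph
begin

text \<open>
  Let \<open>t\<close> be a lower bound for the Rayleigh quotient. Replacing \<open>u\<^sub>i\<close> by \<open>(-1)\<^sup>i \<bar>u\<^sub>i\<bar>\<close>
  keeps the norm of the vector and does not increase its quadratic form, which is already minimal
  for this norm.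
  So the form is unchanged, every single edge contributes the same as before, and the new vector
  is an eigenvector as well. At a zero of the new vector the entries at the neighbours sum to zero
  and have no opposite signs; hence a zero spreads over the whole graph.
\<close>

lemma radial_eigenfunction_least:
  assumes u: "radial_eigenfunction u t"
    and lower: "\<And>v. t * (v \<bullet> v) \<le> v \<bullet> (real_adjacency *v v)"
    and nz: "u (gdist adj x w) \<noteq> 0"
  shows radial_eigenfunction_nonzero: "u (gdist adj x y) \<noteq> 0"
    and radial_eigenfunction_alternates:
      "adj y z \<Longrightarrow> gdist adj x z = gdist adj x y + 1 \<Longrightarrow> u (gdist adj x y) * u (gdist adj x z) < 0"
proof -
  define U :: "real ^ 'v" where "U = (\<chi> y. u (gdist adj x y))"
  define W :: "real ^ 'v" where "W = (\<chi> y. (-1) ^ gdist adj x y * \<bar>u (gdist adj x y)\<bar>)"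
  have quad: "v \<bullet> (real_adjacency *v v) = (\<Sum>y\<in>UNIV. \<Sum>z | adj y z. v $ y * v $ z)" for v
    by (simp add: inner_vec_def real_adjacency_mult sum_distrib_left)
  have AU: "real_adjacency *v U = t *\<^sub>R U"
    using u by (simp add: vec_eq_iff real_adjacency_mult U_def radial_eigenfunction_def)
  have near: "gdist adj x z = gdist adj x y \<or> gdist adj x z = gdist adj x y + 1
      \<or> gdist adj x y = gdist adj x z + 1" if "adj y z" for y z
    using gdist_adj_le[of y z x] gdist_adj_le[of z y x] that adj_sym[of y z] by linarith
  have W_mult: "W $ y * W $ z = ((-1) ^ gdist adj x y * (-1) ^ gdist adj x z) * \<bar>U $ y * U $ z\<bar>" for y z
    by (simp add: W_def U_def abs_mult)
  have WW: "W $ y * W $ z = (if gdist adj x y = gdist adj x z then U $ y * U $ z else - \<bar>U $ y * U $ z\<bar>)"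
    if "adj y z" for y z
    unfolding W_mult using near[OF that] by (auto simp: U_def)
  have le: "W $ y * W $ z \<le> U $ y * U $ z" if "adj y z" for y z
    unfolding WW[OF that] by auto
  have WWUU: "W \<bullet> W = U \<bullet> U"
    unfolding inner_vec_def
    by (intro sum.cong refl) (simp add: W_mult)
  have "U \<bullet> (real_adjacency *v U) = t * (U \<bullet> U)" unfolding AU by simp
  moreover have "W \<bullet> (real_adjacency *v W) \<le> U \<bullet> (real_adjacency *v U)"
    unfolding quad by (intro sum_mono le) simp
  ultimately have eq: "W \<bullet> (real_adjacency *v W) = t * (W \<bullet> W)"
      "W \<bullet> (real_adjacency *v W) = U \<bullet> (real_adjacency *v U)"
    using lower[of W] unfolding WWUU by linarith+
  have AW: "real_adjacency *v W = t *\<^sub>R W"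
    by (rule rayleigh_equality_imp_eigenvector[OF real_adjacency_symmetric lower eq(1)])
  have termwise: "U $ y * U $ z = W $ y * W $ z" if yz: "adj y z" for y z
  proof -
    have "(\<Sum>y\<in>UNIV. \<Sum>z | adj y z. U $ y * U $ z - W $ y * W $ z) = 0"
      using eq(2) unfolding quad by (simp add: sum_subtractf)
    then have "(\<Sum>z | adj y z. U $ y * U $ z - W $ y * W $ z) = 0"
      by (subst (asm) sum_nonneg_eq_0_iff) (auto intro!: sum_nonneg le)
    then show ?thesis
      by (subst (asm) sum_nonneg_eq_0_iff) (use le yz in auto)
  qed
  have zero_step: "U $ z = 0" if y: "U $ y = 0" and yz: "adj y z" for y z
  proof -
    have "W $ z = - ((-1) ^ gdist adj x y) * \<bar>U $ z\<bar>" if "adj y z" for z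
      using near[OF that] y by (auto simp: W_def U_def)
    then have "(\<Sum>z | adj y z. W $ z) = - ((-1) ^ gdist adj x y) * (\<Sum>z | adj y z. \<bar>U $ z\<bar>)"
      by (simp add: sum_distrib_left)
    moreover have "(\<Sum>z | adj y z. W $ z) = 0"
      using arg_cong[OF AW, of "\<lambda>v. v $ y"] y unfolding real_adjacency_mult
      by (simp add: W_def U_def)
    ultimately have "(\<Sum>z | adj y z. \<bar>U $ z\<bar>) = 0" by simp
    then show ?thesis
      by (subst (asm) sum_nonneg_eq_0_iff) (use yz in auto)
  qed
  have nonzero: "U $ y \<noteq> 0" for y
  proof
    assume y: "U $ y = 0"
    have "adj\<^sup>*\<^sup>* y w" using connected by (simp add: connected_graph_def)
    then have "U $ w = 0" by (induction rule: rtranclp_induct) (auto intro: y zero_step)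
    then show False using nz by (simp add: U_def)
  qed
  then show "u (gdist adj x y) \<noteq> 0" by (simp add: U_def)
  show "u (gdist adj x y) * u (gdist adj x z) < 0"
    if yz: "adj y z" and d: "gdist adj x z = gdist adj x y + 1"
  proof -
    have "U $ y * U $ z = - \<bar>U $ y * U $ z\<bar>" using termwise[OF yz] d unfolding WW[OF yz] by simp
    moreover have "U $ y * U $ z \<noteq> 0" using nonzero by simp
    ultimately have "U $ y * U $ z < 0" by linarith
    then show ?thesis by (simp add: U_def)
  qed
qed

end

section \<open>Delsarte cliques\<close>

context distance_regular_graph
begin

text \<open>
  Up to a scalar, \<open>u\<close> gives the entries of the projection onto the eigenspace of \<open>t\<close>. The square of
  the matrix with entries \<open>u (gdist adj y z)\<close> is again given by a radial eigenfunction \<open>g\<close>, and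
  \<open>u\<^sub>0 g - g\<^sub>0 u\<close>, which vanishes at distance 0, is zero everywhere.
\<close>

lemma radial_eigenfunction_convolution:
  assumes u: "radial_eigenfunction u t"
    and lower: "\<And>v. t * (v \<bullet> v) \<le> v \<bullet> (real_adjacency *v v)"
    and nz: "u 0 \<noteq> 0"
  obtains c where "\<And>y z. (\<Sum>w\<in>UNIV. u (gdist adj y w) * u (gdist adj z w)) = c * u (gdist adj y z)"
proof -
  let ?F = "\<lambda>y z. \<Sum>w\<in>UNIV. u (gdist adj y w) * u (gdist adj z w)"
  have "?F y z = ?F y' z'" if "gdist adj y z = gdist adj y' z'" for y z y' z'
    by (rule sum_over_distances_cong[OF that])
  from function_of_distance[of ?F, OF this] obtain g
    where g: "\<And>y z. ?F y z = g (gdist adj y z)" by blast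
  have ug: "radial_eigenfunction g t"
    unfolding radial_eigenfunction_def
  proof (intro allI)
    fix x y
    have "(\<Sum>z | adj y z. g (gdist adj x z)) =
        (\<Sum>w\<in>UNIV. \<Sum>z | adj y z. u (gdist adj x w) * u (gdist adj z w))"
      unfolding g[symmetric] by (rule sum.swap)
    also have "\<dots> = (\<Sum>w\<in>UNIV. u (gdist adj x w) * (\<Sum>z | adj y z. u (gdist adj w z)))"
      by (simp add: sum_distrib_left gdist_sym)
    also have "\<dots> = (\<Sum>w\<in>UNIV. t * (u (gdist adj x w) * u (gdist adj y w)))"
      using u unfolding radial_eigenfunction_def gdist_sym[of y] by (simp add: mult.left_commute)
    also have "\<dots> = t * g (gdist adj x y)"
      unfolding g[symmetric] by (simp only: sum_distrib_left)
    finally show "(\<Sum>z | adj y z. g (gdist adj x z)) = t * g (gdist adj x y)" .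
  qed
  have "radial_eigenfunction (\<lambda>i. u 0 * g i - g 0 * u i) t"
    unfolding radial_eigenfunction_def
  proof (intro allI)
    fix x y
    have "(\<Sum>z | adj y z. u 0 * g (gdist adj x z) - g 0 * u (gdist adj x z)) =
        u 0 * (t * g (gdist adj x y)) - g 0 * (t * u (gdist adj x y))"
      using u ug unfolding radial_eigenfunction_def
      by (simp add: sum_subtractf flip: sum_distrib_left)
    then show "(\<Sum>z | adj y z. u 0 * g (gdist adj x z) - g 0 * u (gdist adj x z)) =
        t * (u 0 * g (gdist adj x y) - g 0 * u (gdist adj x y))"
      by (simp add: right_diff_distrib mult.left_commute)
  qed
  from radial_eigenfunction_nonzero[OF this lower]
  have "u 0 * g (gdist adj y z) = g 0 * u (gdist adj y z)" for y z
    by (metis diff_self eq_iff_diff_eq_0 gdist_self mult.commute)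
  then show thesis
    using nz g by (intro that[of "g 0 / u 0"]) (simp add: field_simps)
qed

text \<open>
  The size of a Delsarte clique makes the quadratic form of the eigenspace projection vanish at the
  indicator vector of the clique, so the indicator vector is orthogonal to the eigenspace.
\<close>

lemma delsarte_clique_sum_zero:
  assumes u: "radial_eigenfunction u t"
    and lower: "\<And>v. t * (v \<bullet> v) \<le> v \<bullet> (real_adjacency *v v)"
    and nz: "u 0 \<noteq> 0"
    and t: "t \<noteq> 0"
    and C: "delsarte_clique adj t C"
  shows "(\<Sum>c\<in>C. u (gdist adj y c)) = 0"
proof -
  obtain g where g: "\<And>y z. (\<Sum>w\<in>UNIV. u (gdist adj y w) * u (gdist adj z w)) = g * u (gdist adj y z)"
    using radial_eigenfunction_convolution[OF u lower nz] by metis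
  \<comment> \<open>the eigenvector equation at distance 0\<close>
  have ku: "real (valency adj) * u 1 = t * u 0"
  proof -
    have "(\<Sum>z | adj y z. u (gdist adj y z)) = (\<Sum>z | adj y z. u 1)"
      using gdist_eq_1_iff[of y] by (intro sum.cong refl) (metis mem_Collect_eq)
    then show ?thesis
      using u unfolding radial_eigenfunction_def valency_eq[of y]
      by (metis gdist_self real_of_card sum_constant)
  qed
  have inner: "(\<Sum>c'\<in>C. u (gdist adj c c')) = 0" if c: "c \<in> C" for c
  proof -
    have "(\<Sum>c'\<in>C - {c}. u (gdist adj c c')) = (\<Sum>c'\<in>C - {c}. u 1)"
      using C c unfolding delsarte_clique_def
      by (intro sum.cong refl arg_cong[of _ _ u]) (metis DiffD1 DiffD2 gdist_eq_1_iff singletonI)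
    also have "\<dots> = (real (card C) - 1) * u 1"
      using c card_gt_0_iff[of C] by (auto simp: card_Diff_singleton of_nat_diff)
    also have "\<dots> = - (real (valency adj) * u 1 / t)"
      using C unfolding delsarte_clique_def by simp
    also have "\<dots> = - u 0"
      unfolding ku using t by simp
    finally show ?thesis using c by (simp add: sum.remove[of C c])
  qed
  have "(\<Sum>y\<in>UNIV. (\<Sum>c\<in>C. u (gdist adj y c))\<^sup>2) =
      (\<Sum>y\<in>UNIV. \<Sum>c\<in>C. \<Sum>c'\<in>C. u (gdist adj c y) * u (gdist adj c' y))"
    by (simp add: power2_eq_square sum_product gdist_sym)
  also have "\<dots> = (\<Sum>c\<in>C. \<Sum>c'\<in>C. \<Sum>y\<in>UNIV. u (gdist adj c y) * u (gdist adj c' y))"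
    by (rule trans[OF sum.swap], rule sum.cong[OF refl], rule sum.swap)
  also have "\<dots> = 0"
    unfolding g by (simp add: inner flip: sum_distrib_left)
  finally show ?thesis by (subst (asm) sum_nonneg_eq_0_iff) auto
qed

end

section \<open>Layers of a clique\<close>

locale distance_regular_graph_clique = distance_regular_graph adj
  for adj :: "'v::finite \<Rightarrow> 'v \<Rightarrow> bool" +
  fixes C :: "'v set"
  assumes C_ne: "C \<noteq> {}" and clique: "\<And>y z. y \<in> C \<Longrightarrow> z \<in> C \<Longrightarrow> y \<noteq> z \<Longrightarrow> adj y z"
begin

lemma setdist_attained: obtains c where "c \<in> C" "gdist adj y c = setdist_graph adj y C"
proof -
  have "setdist_graph adj y C \<in> gdist adj y ` C"
    unfolding setdist_graph_def using C_ne by (intro Min_in) auto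
  then show thesis using that by auto
qed

lemma setdist_le: "c \<in> C \<Longrightarrow> setdist_graph adj y C \<le> gdist adj y c"
  unfolding setdist_graph_def by (intro Min_le) auto

lemma gdist_clique_cases:
  assumes c: "c \<in> C"
  shows "gdist adj y c = setdist_graph adj y C \<or> gdist adj y c = setdist_graph adj y C + 1"
proof -
  obtain c' where c': "c' \<in> C" "gdist adj y c' = setdist_graph adj y C" by (rule setdist_attained)
  then have "gdist adj y c \<le> setdist_graph adj y C + 1"
    using clique[of c' c] gdist_adj_le[of c' c y] c by (cases "c' = c") auto
  then show ?thesis using setdist_le[OF c, of y] by linarith
qed

lemma setdist_triangle: "setdist_graph adj y C \<le> gdist adj y z + setdist_graph adj z C"
proof -
  obtain c where "c \<in> C" "gdist adj z c = setdist_graph adj z C" by (rule setdist_attained)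
  then show ?thesis using setdist_le[of c y] gdist_triangle[of y c z] by simp
qed

text \<open>\<open>K y\<close> clique vertices are at the distance from \<open>y\<close> to the clique, the others are one step further.\<close>

lemma sum_over_clique:
  fixes F :: "nat \<Rightarrow> 'b::comm_semiring_1"
  defines "K y \<equiv> card {c \<in> C. gdist adj y c = setdist_graph adj y C}"
  shows "(\<Sum>c\<in>C. F (gdist adj y c)) =
    of_nat (K y) * F (setdist_graph adj y C) + of_nat (card C - K y) * F (setdist_graph adj y C + 1)"
proof -
  let ?D = "{c \<in> C. gdist adj y c = setdist_graph adj y C}"
  have "(\<Sum>c\<in>C. F (gdist adj y c)) =
      (\<Sum>c\<in>?D. F (gdist adj y c)) + (\<Sum>c\<in>C - ?D. F (gdist adj y c))"
    by (subst sum.subset_diff[of ?D C]) (auto simp: add.commute)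
  also have "(\<Sum>c\<in>C - ?D. F (gdist adj y c)) = (\<Sum>c\<in>C - ?D. F (setdist_graph adj y C + 1))"
  proof (rule sum.cong[OF refl])
    fix c assume "c \<in> C - ?D"
    then have "gdist adj y c = setdist_graph adj y C + 1" using gdist_clique_cases[of c y] by blast
    then show "F (gdist adj y c) = F (setdist_graph adj y C + 1)" by (rule arg_cong)
  qed
  finally show ?thesis
    by (simp add: K_def card_Diff_subset)
qed

text \<open>
  This is the complete regularity of the clique. Count the pairs of a neighbour \<open>z\<close> of \<open>y\<close> and a clique vertex \<open>c\<close> with
  \<open>gdist adj z c = j\<close>. Their number depends only on the layer of \<open>y\<close>. On the other hand, each \<open>z\<close> in
  layer \<open>i\<close> contributes a number \<open>L i\<close> that is zero for \<open>i > j\<close> and positive for \<open>i = j\<close> if layer \<open>j\<close>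
  is nonempty. This triangular system determines the numbers of neighbours in the layers.
\<close>

lemma layer_count_cong:
  assumes K: "\<And>y y'. setdist_graph adj y C = setdist_graph adj y' C \<Longrightarrow>
      card {c \<in> C. gdist adj y c = setdist_graph adj y C} =
      card {c \<in> C. gdist adj y' c = setdist_graph adj y' C}"
    and eq: "setdist_graph adj y C = setdist_graph adj y' C"
  shows "card ({z. adj y z} \<inter> clique_layer adj C j) = card ({z. adj y' z} \<inter> clique_layer adj C j)"
proof (induction j rule: less_induct)
  case (less j)
  let ?s = "\<lambda>z. setdist_graph adj z C"
  have cong: "(\<Sum>c\<in>C. F (gdist adj z c)) = (\<Sum>c\<in>C. F (gdist adj z' c))"
    if "?s z = ?s z'" for z z' and F :: "nat \<Rightarrow> nat"
    unfolding sum_over_clique using K[OF that] that by simp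
  define k where "k z = card {c \<in> C. gdist adj z c = j}" for z
  have k_sum: "k z = (\<Sum>c\<in>C. if gdist adj z c = j then 1 else 0)" for z
    by (simp add: k_def sum.If_cases Int_def)
  \<comment> \<open>on an index \<open>i\<close> of a nonempty layer, \<open>L i\<close> is the common value of \<open>k\<close> on that layer\<close>
  obtain L where L: "\<And>z. k z = L (?s z)"
  proof
    show "k z = k (SOME z'. ?s z' = ?s z)" for z
      unfolding k_sum by (rule cong) (metis (mono_tags, lifting) someI)
  qed
  have double: "(\<Sum>i\<le>j. card ({z. adj y z} \<inter> clique_layer adj C i) * L i) =
      (\<Sum>c\<in>C. card ({z. adj y z} \<inter> gsphere adj j c))" for y
  proof -
    have far: "L (?s z) = 0" if "?s z > j" for z
      using setdist_le[of _ z] that by (auto simp: k_def leD simp flip: L)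
    have "(\<Sum>c\<in>C. card ({z. adj y z} \<inter> gsphere adj j c)) =
        (\<Sum>c\<in>C. \<Sum>z | adj y z. if gdist adj z c = j then 1 else 0)"
      by (intro sum.cong refl) (simp add: gsphere_def sum.If_cases Int_def gdist_sym)
    also have "\<dots> = (\<Sum>z | adj y z. L (?s z))"
      unfolding L[symmetric] k_sum by (rule sum.swap)
    also have "\<dots> = (\<Sum>z | adj y z \<and> ?s z \<le> j. L (?s z))"
      by (rule sum.mono_neutral_right) (use far in \<open>auto simp: not_le\<close>)
    also have "\<dots> = (\<Sum>i\<le>j. \<Sum>z | z \<in> {z. adj y z \<and> ?s z \<le> j} \<and> ?s z = i. L (?s z))"
      by (rule sum.group[symmetric]) auto
    also have "\<dots> = (\<Sum>i\<le>j. \<Sum>z\<in>{z. adj y z} \<inter> clique_layer adj C i. L i)"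
      by (intro sum.cong refl) (auto simp: clique_layer_def)
    finally show ?thesis by simp
  qed
  have P: "card ({z. adj y z} \<inter> gsphere adj j c) = card ({z. adj y' z} \<inter> gsphere adj j c')"
    if "gdist adj y c = gdist adj y' c'" for y y' c c'
    using card_gsphere_Int_cong[OF that, of 1 j] unfolding gsphere_1 .
  obtain p where p: "\<And>y c. card ({z. adj y z} \<inter> gsphere adj j c) = p (gdist adj y c)"
    using function_of_distance[of "\<lambda>y c. card ({z. adj y z} \<inter> gsphere adj j c)"] P by metis
  have "(\<Sum>i\<le>j. card ({z. adj y z} \<inter> clique_layer adj C i) * L i) =
      (\<Sum>i\<le>j. card ({z. adj y' z} \<inter> clique_layer adj C i) * L i)"
    unfolding double p by (rule cong[OF eq])
  then have top: "card ({z. adj y z} \<inter> clique_layer adj C j) * L j =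
      card ({z. adj y' z} \<inter> clique_layer adj C j) * L j"
    using less by (simp add: lessThan_Suc_atMost[symmetric])
  show ?case
  proof (cases "clique_layer adj C j = {}")
    case False
    then obtain z where z: "?s z = j" by (auto simp: clique_layer_def)
    obtain c where "c \<in> C" "gdist adj z c = j" using setdist_attained[of z] z by metis
    then have "k z > 0" unfolding k_def by (auto simp: card_gt_0_iff)
    then show ?thesis using top L[of z] z by simp
  qed simp
qed

text \<open>
  The clique lies in the spheres of radius \<open>i\<close> and \<open>i + 1\<close> around a vertex \<open>y\<close> of layer \<open>i\<close>, so
  the vanishing sum is a linear equation \<open>K u\<^sub>i + (card C - K) u\<^sub>i\<^sub>+\<^sub>1 = 0\<close> for the number \<open>K\<close>
  of clique vertices nearest to \<open>y\<close>. Since \<open>u\<^sub>i\<close> and \<open>u\<^sub>i\<^sub>+\<^sub>1\<close> have opposite signs, it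
  determines \<open>K\<close>; since \<open>u\<^sub>i\<close> is nonzero, it excludes \<open>K = card C\<close>.
\<close>

lemma
  assumes nonzero: "\<And>y z. u (gdist adj y z) \<noteq> (0::real)"
    and alternates: "\<And>x y z. adj y z \<Longrightarrow> gdist adj x z = gdist adj x y + 1 \<Longrightarrow>
      u (gdist adj x y) * u (gdist adj x z) < 0"
    and sum_zero: "\<And>y. (\<Sum>c\<in>C. u (gdist adj y c)) = 0"
  shows exists_far_clique_vertex: "\<exists>c\<in>C. gdist adj y c = setdist_graph adj y C + 1"
    and near_clique_count_cong: "setdist_graph adj y C = setdist_graph adj y' C \<Longrightarrow>
      card {c \<in> C. gdist adj y c = setdist_graph adj y C} =
      card {c \<in> C. gdist adj y' c = setdist_graph adj y' C}"
proof -
  define s where "s y = setdist_graph adj y C" for y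
  define K where "K y = card {c \<in> C. gdist adj y c = s y}" for y
  have K_le: "K y \<le> card C" for y
    unfolding K_def by (intro card_mono) auto
  have eq: "real (K y) * u (s y) + (real (card C) - real (K y)) * u (s y + 1) = 0" for y
    using sum_zero[of y] K_le[of y]
    unfolding sum_over_clique K_def[symmetric, unfolded s_def] s_def by (simp add: of_nat_diff)
  have far: "\<exists>c\<in>C. gdist adj y c = s y + 1" for y
  proof (rule ccontr)
    assume none: "\<not> ?thesis"
    then have "{c \<in> C. gdist adj y c = s y} = C"
      using gdist_clique_cases[of _ y] by (auto simp: s_def)
    then have "K y = card C" by (simp add: K_def)
    then have "u (s y) = 0" using eq[of y] C_ne by simp
    moreover obtain c where "c \<in> C" "gdist adj y c = s y"
      unfolding s_def by (rule setdist_attained)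
    ultimately show False using nonzero[of y c] by simp
  qed
  then show "\<exists>c\<in>C. gdist adj y c = setdist_graph adj y C + 1" by (simp add: s_def)
  show "card {c \<in> C. gdist adj y c = setdist_graph adj y C} =
      card {c \<in> C. gdist adj y' c = setdist_graph adj y' C}"
    if same: "setdist_graph adj y C = setdist_graph adj y' C"
  proof -
    have s: "s y = s y'" using same by (simp add: s_def)
    obtain c where c: "gdist adj c y = s y + 1" using far[of y] gdist_sym by metis
    obtain w where w: "gdist adj c w = s y" "gdist adj w y = 1"
      using gdist_geodesic[of "s y" c y] c by auto
    then have "u (s y) * u (s y + 1) < 0"
      using alternates[of w y c] c gdist_eq_1_iff[of w y] by simp
    then have "u (s y) \<noteq> u (s y + 1)"
      using not_square_less_zero[of "u (s y)"] by auto
    moreover have "(real (K y) - real (K y')) * (u (s y) - u (s y + 1)) = 0"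
      using eq[of y] eq[of y'] s by (simp add: algebra_simps)
    ultimately have "K y = K y'" by simp
    then show ?thesis by (simp add: K_def s_def)
  qed
qed

section \<open>The cells\<close>

text \<open>
  No vertex is equidistant from the whole clique, and the number of clique vertices
  nearest to a vertex depends only on its layer.
\<close>

context
  fixes x :: 'v
  assumes x: "x \<in> C"
    and far: "\<And>y. \<exists>c\<in>C. gdist adj y c = setdist_graph adj y C + 1"
    and near: "\<And>y y'. setdist_graph adj y C = setdist_graph adj y' C \<Longrightarrow>
      card {c \<in> C. gdist adj y c = setdist_graph adj y C} =
      card {c \<in> C. gdist adj y' c = setdist_graph adj y' C}"
begin

lemma mem_cell_minus_iff: "y \<in> cell_minus adj C x i \<longleftrightarrow> setdist_graph adj y C = i \<and> gdist adj x y = i"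
  by (auto simp: cell_minus_def clique_layer_def gsphere_def)

lemma mem_cell_plus_iff: "y \<in> cell_plus adj C x i \<longleftrightarrow> setdist_graph adj y C = i \<and> gdist adj x y = i + 1"
  by (auto simp: cell_plus_def clique_layer_def gsphere_def)

lemma gdist_base_cases:
  "gdist adj x y = setdist_graph adj y C \<or> gdist adj x y = setdist_graph adj y C + 1"
  using gdist_clique_cases[OF x, of y] by (simp add: gdist_sym)

lemma layer_iff: "z \<in> clique_layer adj C j \<longleftrightarrow> z \<in> cell_minus adj C x j \<or> z \<in> cell_plus adj C x j"
  using gdist_base_cases[of z] by (auto simp: mem_cell_minus_iff mem_cell_plus_iff clique_layer_def)

lemma sphere_0_iff: "z \<in> gsphere adj 0 x \<longleftrightarrow> z \<in> cell_minus adj C x 0"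
  using gdist_base_cases[of z] by (auto simp: mem_cell_minus_iff gsphere_def)

lemma sphere_Suc_iff:
  "z \<in> gsphere adj (Suc j) x \<longleftrightarrow> z \<in> cell_minus adj C x (Suc j) \<or> z \<in> cell_plus adj C x j"
  using gdist_base_cases[of z] by (auto simp: mem_cell_minus_iff mem_cell_plus_iff gsphere_def)

lemma card_Int_layer:
  "card (S \<inter> clique_layer adj C j) = card (S \<inter> cell_minus adj C x j) + card (S \<inter> cell_plus adj C x j)"
proof -
  have "S \<inter> clique_layer adj C j = (S \<inter> cell_minus adj C x j) \<union> (S \<inter> cell_plus adj C x j)"
    using layer_iff by blast
  then show ?thesis
    by (simp add: card_Un_disjoint disjoint_iff mem_cell_minus_iff mem_cell_plus_iff)
qed

lemma card_Int_sphere_0: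
  "card (S \<inter> gsphere adj 0 x) = card (S \<inter> cell_minus adj C x 0)"
  by (intro arg_cong[of _ _ card]) (use sphere_0_iff in blast)

lemma card_Int_sphere_Suc:
  "card (S \<inter> gsphere adj (Suc j) x) =
     card (S \<inter> cell_minus adj C x (Suc j)) + card (S \<inter> cell_plus adj C x j)"
proof -
  have "S \<inter> gsphere adj (Suc j) x = (S \<inter> cell_minus adj C x (Suc j)) \<union> (S \<inter> cell_plus adj C x j)"
    using sphere_Suc_iff by blast
  then show ?thesis
    by (simp add: card_Un_disjoint disjoint_iff mem_cell_minus_iff mem_cell_plus_iff)
qed

text \<open>
  Each layer is the union of \<open>C\<^sub>j\<^sup>-\<close> and \<open>C\<^sub>j\<^sup>+\<close>, and each sphere around \<open>x\<close> is the union of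
  \<open>C\<^sub>j\<^sub>-\<^sub>1\<^sup>+\<close> and \<open>C\<^sub>j\<^sup>-\<close>. Going through the cells in the order
  \<open>C\<^sub>0\<^sup>-, C\<^sub>0\<^sup>+, C\<^sub>1\<^sup>-, C\<^sub>1\<^sup>+, \<dots>\<close>, the number of neighbours in a cell is a difference of the
  number in a layer or a sphere and the number in the preceding cell.
\<close>

lemma cell_count_cong:
  assumes s: "setdist_graph adj y C = setdist_graph adj y' C"
    and g: "gdist adj x y = gdist adj x y'"
  shows "card ({z. adj y z} \<inter> cell_minus adj C x j) = card ({z. adj y' z} \<inter> cell_minus adj C x j)"
    and "card ({z. adj y z} \<inter> cell_plus adj C x j) = card ({z. adj y' z} \<inter> cell_plus adj C x j)"
proof -
  have layer: "card ({z. adj y z} \<inter> clique_layer adj C j) = card ({z. adj y' z} \<inter> clique_layer adj C j)" for j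
    using near s by (rule layer_count_cong)
  have sphere: "card ({z. adj y z} \<inter> gsphere adj j x) = card ({z. adj y' z} \<inter> gsphere adj j x)" for j
    using card_gsphere_Int_cong[of y x y' x 1 j] g unfolding gsphere_1 by (simp add: gdist_sym)
  have "card ({z. adj y z} \<inter> cell_minus adj C x j) = card ({z. adj y' z} \<inter> cell_minus adj C x j) \<and>
      card ({z. adj y z} \<inter> cell_plus adj C x j) = card ({z. adj y' z} \<inter> cell_plus adj C x j)"
  proof (induction j)
    case 0
    show ?case using sphere[of 0] layer[of 0] unfolding card_Int_sphere_0 card_Int_layer by linarith
  next
    case (Suc j)
    then show ?case using sphere[of "Suc j"] layer[of "Suc j"]
      unfolding card_Int_sphere_Suc card_Int_layer by linarith
  qed
  then show "card ({z. adj y z} \<inter> cell_minus adj C x j) = card ({z. adj y' z} \<inter> cell_minus adj C x j)"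
    and "card ({z. adj y z} \<inter> cell_plus adj C x j) = card ({z. adj y' z} \<inter> cell_plus adj C x j)"
    by blast+
qed

lemma setdist_less_diameter: "setdist_graph adj y C < graph_diameter adj"
proof -
  obtain c where "gdist adj y c = setdist_graph adj y C + 1" using far by blast
  then show ?thesis using gdist_le_diameter[of y c] by simp
qed

text \<open>
  A vertex at maximal distance from \<open>x\<close> is in the last plus cell. A geodesic from it to a
  nearest clique vertex meets all the other plus cells.
\<close>

lemma cell_plus_nonempty:
  assumes j: "j < graph_diameter adj"
  shows "cell_plus adj C x j \<noteq> {}"
proof -
  let ?d = "graph_diameter adj"
  obtain w where w: "gdist adj x w = ?d" using gdist_diameter_attained by blast
  have sw: "setdist_graph adj w C = ?d - 1"
    using gdist_base_cases[of w] w setdist_less_diameter[of w] by linarith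
  obtain c where c: "c \<in> C" "gdist adj w c = ?d - 1" using setdist_attained[of w] sw by metis
  have "j \<le> gdist adj c w" using c j gdist_sym[of c w] by simp
  then obtain v where v: "gdist adj c v = j" "gdist adj v w = ?d - 1 - j"
    using gdist_geodesic[of j c w] c gdist_sym[of c w] by metis
  have "setdist_graph adj v C \<le> j" using setdist_le[OF c(1), of v] v gdist_sym[of c v] by simp
  moreover have "?d \<le> gdist adj x v + (?d - 1 - j)" using gdist_triangle[of x w v] v w by simp
  ultimately have "v \<in> cell_plus adj C x j"
    using gdist_base_cases[of v] j unfolding mem_cell_plus_iff by linarith
  then show ?thesis by auto
qed

text \<open>
  If the last minus cell were empty, the last layer would be the sphere of maximal radius around \<open>x\<close>.
  It contains the spheres of the same radius around the other clique vertices, which have the same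
  size, so all of its vertices would be at maximal distance from the whole clique. A geodesic
  from \<open>x\<close> to a vertex of the last minus cell meets all the other minus cells.
\<close>

lemma cell_minus_nonempty:
  assumes j: "j < graph_diameter adj"
  shows "cell_minus adj C x j \<noteq> {}"
proof -
  let ?d = "graph_diameter adj"
  have "\<exists>y. setdist_graph adj y C = ?d - 1 \<and> gdist adj x y = ?d - 1"
  proof (rule ccontr)
    assume none: "\<not> ?thesis"
    have sub: "gsphere adj ?d c \<subseteq> clique_layer adj C (?d - 1)" if c: "c \<in> C" for c
    proof
      fix y assume "y \<in> gsphere adj ?d c"
      then have "gdist adj y c = ?d" by (simp add: gsphere_def gdist_sym)
      then show "y \<in> clique_layer adj C (?d - 1)"
        using gdist_clique_cases[OF c, of y] setdist_less_diameter[of y]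
        by (auto simp: clique_layer_def)
    qed
    have "clique_layer adj C (?d - 1) \<subseteq> gsphere adj ?d x"
    proof
      fix y assume "y \<in> clique_layer adj C (?d - 1)"
      then have "setdist_graph adj y C = ?d - 1" by (simp add: clique_layer_def)
      then show "y \<in> gsphere adj ?d x"
        using none gdist_base_cases[of y] j by (auto simp: gsphere_def)
    qed
    then have layer: "clique_layer adj C (?d - 1) = gsphere adj ?d x" using sub[OF x] by blast
    have all: "gsphere adj ?d c = gsphere adj ?d x" if "c \<in> C" for c
      using sub[OF that] card_gsphere_cong[of ?d c x] unfolding layer
      by (intro card_subset_eq) auto
    obtain w where w: "gdist adj x w = ?d" using gdist_diameter_attained by blast
    obtain c where c: "c \<in> C" "gdist adj w c = setdist_graph adj w C" by (rule setdist_attained)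
    have "w \<in> gsphere adj ?d c" using all[OF c(1)] w by (simp add: gsphere_def)
    then have "setdist_graph adj w C = ?d" using c by (simp add: gsphere_def gdist_sym)
    then show False using setdist_less_diameter[of w] by simp
  qed
  then obtain y where y: "setdist_graph adj y C = ?d - 1" "gdist adj x y = ?d - 1" by blast
  obtain v where v: "gdist adj x v = j" "gdist adj v y = ?d - 1 - j"
    using gdist_geodesic[of j x y] y j by force
  have "setdist_graph adj v C \<le> j" using setdist_le[OF x, of v] v gdist_sym[of x v] by simp
  moreover have "?d - 1 \<le> (?d - 1 - j) + setdist_graph adj v C"
    using setdist_triangle[of y v] y v gdist_sym[of y v] by simp
  ultimately have "v \<in> cell_minus adj C x j"
    using v j unfolding mem_cell_minus_iff by linarith
  then show ?thesis by auto
qed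

lemma cells_equitable:
  assumes d: "graph_diameter adj > 0"
  shows "equitable_partition adj
    ((\<lambda>i. cell_minus adj C x i) ` {0..graph_diameter adj - 1} \<union>
     (\<lambda>i. cell_plus adj C x i) ` {0..graph_diameter adj - 1})"
    (is "equitable_partition adj ?P")
proof -
  have cell: "\<exists>i j. \<forall>z\<in>Q. setdist_graph adj z C = i \<and> gdist adj x z = j" if "Q \<in> ?P" for Q
    using that by (auto simp: mem_cell_minus_iff mem_cell_plus_iff)
  have "partition_on UNIV ?P"
  proof (rule partition_onI)
    show "\<Union> ?P = UNIV"
    proof (intro set_eqI iffI UNIV_I)
      fix y
      have "setdist_graph adj y C \<in> {0..graph_diameter adj - 1}"
        using setdist_less_diameter[of y] by simp
      moreover have "y \<in> cell_minus adj C x (setdist_graph adj y C) \<union>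
          cell_plus adj C x (setdist_graph adj y C)"
        using gdist_base_cases[of y] by (simp add: mem_cell_minus_iff mem_cell_plus_iff)
      ultimately show "y \<in> \<Union> ?P" by blast
    qed
    show "disjnt p q" if "p \<in> ?P" "q \<in> ?P" "p \<noteq> q" for p q
    proof (rule ccontr)
      assume "\<not> disjnt p q"
      then obtain y where y: "y \<in> p" "y \<in> q" by (auto simp: disjnt_iff)
      have "r = (if gdist adj x y = setdist_graph adj y C then cell_minus adj C x (setdist_graph adj y C)
          else cell_plus adj C x (setdist_graph adj y C))" if "r \<in> ?P" "y \<in> r" for r
        using that by (auto simp: mem_cell_minus_iff mem_cell_plus_iff)
      then show False using that y by metis
    qed
    show "{} \<notin> ?P"
      using d by (auto simp: cell_minus_nonempty[THEN not_sym] cell_plus_nonempty[THEN not_sym])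
  qed
  moreover have "\<exists>n. \<forall>z\<in>P. card (gsphere adj 1 z \<inter> Q) = n" if "P \<in> ?P" "Q \<in> ?P" for P Q
  proof (cases "P = {}")
    case False
    then obtain y where y: "y \<in> P" by auto
    obtain i j where ij: "\<And>z. z \<in> P \<Longrightarrow> setdist_graph adj z C = i \<and> gdist adj x z = j"
      using cell[OF \<open>P \<in> ?P\<close>] by blast
    obtain m where Q: "Q = cell_minus adj C x m \<or> Q = cell_plus adj C x m"
      using \<open>Q \<in> ?P\<close> by auto
    have "card ({w. adj z w} \<inter> Q) = card ({w. adj y w} \<inter> Q)" if z: "z \<in> P" for z
    proof -
      have "setdist_graph adj z C = setdist_graph adj y C" "gdist adj x z = gdist adj x y"
        using ij[OF y] ij[OF z] by simp_all
      from cell_count_cong[OF this, of m] show ?thesis using Q by auto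
    qed
    then show ?thesis unfolding gsphere_1 by blast
  qed auto
  ultimately show ?thesis unfolding equitable_partition_def by blast
qed

end
end

theorem proposition5p6:
  fixes adj :: "'v::finite \<Rightarrow> 'v \<Rightarrow> bool"
    and d :: nat
    and E :: "nat \<Rightarrow> complex ^ 'v ^ 'v"
    and \<theta> :: "nat \<Rightarrow> real"
    and \<theta>s \<phi> \<psi> :: "nat \<Rightarrow> complex"
    and q h hs s ss r1 r2 :: complex
    and C :: "'v set"
    and x :: 'v
  assumes "simple_graph adj"
    and "connected_graph adj"
    and "graph_diameter adj = d"
    and "d \<ge> 3"
    and "distance_regular adj"
    and "bij_betw E {..d} (primitive_idempotents (bose_mesner adj))"
    and "E 0 = (\<chi> y z. 1 / of_nat CARD('v))"
    and "adjacency_matrix adj = (\<Sum>i\<le>d. complex_of_real (\<theta> i) *k E i)"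
    and "q_polynomial d E"
    and "\<And>i j. i < j \<Longrightarrow> j \<le> d \<Longrightarrow> \<theta> i > \<theta> j"
    and "delsarte_clique adj (\<theta> d) C"
    and "x \<in> C"
    and "dual_adjacency_matrix E x = (\<Sum>i\<le>d. \<theta>s i *k dual_idempotent adj x i)"
    and "leonard_system (primary_module adj x) d (adjacency_matrix adj) (dual_adjacency_matrix E x)
           E (dual_idempotent adj x)"
    and "parameter_array (primary_module adj x) d (adjacency_matrix adj) (dual_adjacency_matrix E x)
           E (dual_idempotent adj x) (\<lambda>i. complex_of_real (\<theta> i)) \<theta>s \<phi> \<psi>"
    and "q \<noteq> 0"
    and "q\<^sup>2 \<noteq> 1"
    and "q_racah_array d q h hs s ss r1 r2 (\<lambda>i. complex_of_real (\<theta> i)) \<theta>s \<phi> \<psi>"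
  shows "equitable_partition adj
           ((\<lambda>i. cell_minus adj C x i) ` {0..d - 1} \<union> (\<lambda>i. cell_plus adj C x i) ` {0..d - 1})"
proof -
  interpret distance_regular_graph adj
    using assms(1,2,5) by unfold_locales
  interpret distance_regular_graph_clique adj C
    using assms(11) by unfold_locales (auto simp: delsarte_clique_def)
  note spectrum = assms(6,8)
  obtain w where w: "gdist adj x w = d" using gdist_diameter_attained assms(3) by blast
  then obtain y where y: "adj x y"
    using gdist_geodesic[of 1 x w] assms(4) gdist_eq_1_iff[of x] by fastforce
  note bound = rayleigh_bound[OF spectrum assms(10) y]
  obtain u a b where u: "radial_eigenfunction u (\<theta> d)" and ab: "u (gdist adj a b) \<noteq> 0"
    using radial_eigenfunction_exists[OF spectrum, of d] by blast
  have u0: "u 0 \<noteq> 0"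
    using radial_eigenfunction_nonzero[OF u bound(2) ab, of a] by simp
  then have at_base: "u (gdist adj y y) \<noteq> 0" for y by simp
  have "\<theta> d \<noteq> 0" using bound(1) by simp
  note u_facts = radial_eigenfunction_nonzero[OF u bound(2) at_base]
    radial_eigenfunction_alternates[OF u bound(2) at_base]
    delsarte_clique_sum_zero[OF u bound(2) u0 this assms(11)]
  have "graph_diameter adj > 0" using assms(3,4) by simp
  from cells_equitable[OF assms(12) exists_far_clique_vertex[OF u_facts]
      near_clique_count_cong[OF u_facts] this]
  show ?thesis unfolding assms(3) by simp
qed

end
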